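(* Let $\mathbb{K}\in\{\mathbb{R},\mathbb{C}\}$, let $A,E\in\mathbb{K}^{m\times n}$, put $\widetilde{A}=A+E$, and let $k=\operatorname{rank}(A)$. Let $I\subset\{1,\dots,m\}$ and $J\subset\{1,\dots,n\}$, and put $C=A(:,J)$, $R=A(I,:)$, $U=A(I,J)$, $\widetilde{C}=\widetilde{A}(:,J)$, $\widetilde{R}=\widetilde{A}(I,:)$, $E_I=E(I,:)$, $E_J=E(:,J)$. Assume $\operatorname{rank}(C)=\operatorname{rank}(U)=\operatorname{rank}(R)=k$. Let $A=W_k\Sigma_kV_k^*$ be a compact SVD of $A$, and let $W_{k,I}=W_k(I,:)$, $V_{k,J}=V_k(J,:)$. Let $\|\cdot\|$ be a normalized, uniformly generated, unitarily invariant, submultiplicative norm. Then \[ \|A-\widetilde{C}_k\widetilde{C}_k^\dagger \widetilde{A}\widetilde{R}_k^\dagger \widetilde{R}_k\|\leq 2\left(\|E_I\|\|W_{k,I}^\dagger\|+\|E_J\|\|V_{k,J}^\dagger\|+\tfrac32\|E\|\right), \] and hence \[\|A-\widetilde{C}_k\widetilde{C}_k^\dagger \widetilde{A}\widetilde{R}_k^\dagger \widetilde{R}_k\|\leq 2\|E\|\left(\|W_{k,I}^\dagger\|+\|V_{k,J}^\dagger\|+\tfrac32\right).\]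
   Context: For a matrix $B$ and index sets $I,J$, $B(I,J)$ is the submatrix with rows in $I$ and columns in $J$; $B(I,:)$ keeps all columns and $B(:,J)$ keeps all rows. $B^\dagger$ is the Moore--Penrose pseudoinverse. $B_k$ denotes the truncated SVD of order $k$ of $B$ (best rank-$k$ approximation), and $B_k^\dagger=(B_k)^\dagger$. The compact SVD of a rank-$k$ matrix $A\in\mathbb{K}^{m\times n}$ is $A=W_k\Sigma_kV_k^*$ with $W_k\in\mathbb{K}^{m\times k}$, $V_k\in\mathbb{K}^{n\times k}$ having orthonormal columns and $\Sigma_k$ the $k\times k$ diagonal matrix of the positive singular values in descending order. A "normalized, uniformly generated, unitarily invariant, submultiplicative norm" is a family of norms $\|\cdot\|:\bigcup_{p,q\ge 1}\mathbb{K}^{p\times q}\to\mathbb{R}$ (a norm on each $\mathbb{K}^{p\times q}$) such that: $\|x\|=\|x\|_2$ (Euclidean norm) for every vector $x$ viewed as a matrix (normalized); there is a single symmetric function $\phi$ with $\|B\|=\phi(\sigma_1(B),\dots,\sigma_r(B))$, $r=\operatorname{rank}(B)$, for matrices $B$ of every size (uniformly generated); $\|\cdot\|$ is invariant under left and right multiplication by unitary matrices; and $\|BD\|\le\|B\|\|D\|$ whenever $BD$ is defined. All Schatten $p$-norms, $1\le p\le\infty$, are examples. *)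

theory Defs
  imports
    "HOL-Analysis.Analysis"
    "Jordan_Normal_Form.Schur_Decomposition"
    "Jordan_Normal_Form.DL_Rank"
    "Jordan_Normal_Form.DL_Submatrix"
begin

text \<open>
  The scalar field is a set \<open>K\<close> of complex numbers, later assumed to be
  \<open>\<real>\<close> or \<open>UNIV\<close>. Real matrices are complex matrices all of whose entries are real;
  the rank and the singular values of a real matrix are the same over either field.
  Row and column indices start at 0, and \<open>submatrix B I J\<close> keeps the rows in \<open>I\<close>
  and the columns in \<open>J\<close>, so \<open>B(I,:)\<close> is \<open>submatrix B I UNIV\<close>.
\<close>

definition kmat :: "complex set \<Rightarrow> nat \<Rightarrow> nat \<Rightarrow> complex mat set" where
  "kmat K p q = {B \<in> carrier_mat p q. elements_mat B \<subseteq> K}"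

definition mrank :: "complex mat \<Rightarrow> nat" where
  "mrank B = vec_space.rank (dim_row B) B"

definition unitary_mats :: "complex set \<Rightarrow> nat \<Rightarrow> complex mat set" where
  "unitary_mats K p =
     {Q \<in> kmat K p p. mat_adjoint Q * Q = 1\<^sub>m p \<and> Q * mat_adjoint Q = 1\<^sub>m p}"

text \<open>Moore--Penrose pseudoinverse: the unique solution of the four Penrose equations.\<close>

definition is_pinv :: "complex mat \<Rightarrow> complex mat \<Rightarrow> bool" where
  "is_pinv B X \<longleftrightarrow>
     X \<in> carrier_mat (dim_col B) (dim_row B) \<and>
     B * X * B = B \<and> X * B * X = X \<and>
     mat_adjoint (B * X) = B * X \<and> mat_adjoint (X * B) = X * B"

definition pinv :: "complex mat \<Rightarrow> complex mat" where
  "pinv B = (THE X. is_pinv B X)"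

text \<open>
  The positive singular values in descending order, with multiplicity: the square roots
  of the nonzero eigenvalues of \<open>B\<^sup>* B\<close>. These eigenvalues are real and nonnegative, so
  taking \<open>Re\<close> only changes their type; the length of the list is the rank of \<open>B\<close>.
\<close>

definition sing_vals :: "complex mat \<Rightarrow> real list" where
  "sing_vals B =
     rev (sorted_list_of_multiset
       (image_mset (\<lambda>z. sqrt (Re z))
         (filter_mset (\<lambda>z. z \<noteq> 0) (proots (char_poly (mat_adjoint B * B))))))"

definition compact_svd ::
    "complex set \<Rightarrow> complex mat \<Rightarrow> complex mat \<Rightarrow> complex mat \<Rightarrow> complex mat \<Rightarrow> bool" where
  "compact_svd K B W S V \<longleftrightarrow>
     (let r = mrank B in
       W \<in> kmat K (dim_row B) r \<and> V \<in> kmat K (dim_col B) r \<and>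
       mat_adjoint W * W = 1\<^sub>m r \<and> mat_adjoint V * V = 1\<^sub>m r \<and>
       S = mat_diag r (\<lambda>i. complex_of_real (sing_vals B ! i)) \<and>
       B = W * S * mat_adjoint V)"

text \<open>
  Truncation is a relation because it depends on the chosen SVD when the
  \<open>k\<close>-th and \<open>(k+1)\<close>-st singular values agree. If \<open>k\<close> is at least the rank of \<open>B\<close>,
  nothing is cut off and the truncation is \<open>B\<close> itself.
\<close>

definition truncated_svd :: "complex set \<Rightarrow> nat \<Rightarrow> complex mat \<Rightarrow> complex mat \<Rightarrow> bool" where
  "truncated_svd K k B Bk \<longleftrightarrow>
     (\<exists>W S V. compact_svd K B W S V \<and>
        Bk = submatrix W UNIV {..<k} * submatrix S {..<k} {..<k}
               * mat_adjoint (submatrix V UNIV {..<k}))"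

text \<open>
  Only the values of the norm on \<open>K\<close>-matrices are constrained.
  The clause \<open>empty\<close> fixes the convention that a matrix without rows or columns has
  norm 0; it is needed for \<open>k = 0\<close> and for empty index sets, and it says nothing about
  matrices of size \<open>p \<times> q\<close> with \<open>p, q \<ge> 1\<close>, to which all the other clauses refer.
\<close>

locale nuui_submult_norm =
  fixes K :: "complex set" and nrm :: "complex mat \<Rightarrow> real"
  assumes empty: "\<And>B. dim_row B = 0 \<or> dim_col B = 0 \<Longrightarrow> nrm B = 0"
    and nonneg: "\<And>p q B. p \<ge> 1 \<Longrightarrow> q \<ge> 1 \<Longrightarrow> B \<in> kmat K p q \<Longrightarrow> nrm B \<ge> 0"
    and definite: "\<And>p q B. p \<ge> 1 \<Longrightarrow> q \<ge> 1 \<Longrightarrow> B \<in> kmat K p q \<Longrightarrow>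
      nrm B = 0 \<longleftrightarrow> B = 0\<^sub>m p q"
    and homogeneous: "\<And>p q B c. p \<ge> 1 \<Longrightarrow> q \<ge> 1 \<Longrightarrow> B \<in> kmat K p q \<Longrightarrow> c \<in> K \<Longrightarrow>
      nrm (c \<cdot>\<^sub>m B) = cmod c * nrm B"
    and triangle: "\<And>p q B D. p \<ge> 1 \<Longrightarrow> q \<ge> 1 \<Longrightarrow> B \<in> kmat K p q \<Longrightarrow> D \<in> kmat K p q \<Longrightarrow>
      nrm (B + D) \<le> nrm B + nrm D"
    and normalized: "\<And>p x. p \<ge> 1 \<Longrightarrow> x \<in> kmat K p 1 \<Longrightarrow>
      nrm x = sqrt (\<Sum>i<p. (cmod (x $$ (i, 0)))\<^sup>2)"
    and uniformly_generated: "\<exists>\<phi> :: real list \<Rightarrow> real.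
      (\<forall>xs ys. mset xs = mset ys \<longrightarrow> \<phi> xs = \<phi> ys) \<and>
      (\<forall>p q. p \<ge> 1 \<longrightarrow> q \<ge> 1 \<longrightarrow> (\<forall>B \<in> kmat K p q. nrm B = \<phi> (sing_vals B)))"
    and unitary_left: "\<And>p q B Q. p \<ge> 1 \<Longrightarrow> q \<ge> 1 \<Longrightarrow> B \<in> kmat K p q \<Longrightarrow>
      Q \<in> unitary_mats K p \<Longrightarrow> nrm (Q * B) = nrm B"
    and unitary_right: "\<And>p q B Q. p \<ge> 1 \<Longrightarrow> q \<ge> 1 \<Longrightarrow> B \<in> kmat K p q \<Longrightarrow>
      Q \<in> unitary_mats K q \<Longrightarrow> nrm (B * Q) = nrm B"
    and submultiplicative: "\<And>p q r B D. p \<ge> 1 \<Longrightarrow> q \<ge> 1 \<Longrightarrow> r \<ge> 1 \<Longrightarrow>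
      B \<in> kmat K p q \<Longrightarrow> D \<in> kmat K q r \<Longrightarrow> nrm (B * D) \<le> nrm B * nrm D"

end

theory Submission
  imports Defs
begin

text \<open>
  Let \<open>P\<close> and \<open>Q\<close> be the orthogonal projections onto the column space of the truncation of
  \<open>A(:,J) + E(:,J)\<close> and onto the row space of the truncation of \<open>A(I,:) + E(I,:)\<close>. The error
  splits as
  \<open>A - P (A + E) Q = (1 - P) A + P A (1 - Q) - P E Q\<close>,
  and multiplication by an orthogonal projection never increases a unitarily invariant norm,
  because a projection is the average of the identity and of a unitary reflection
  (\<open>nrm_projection_mult_le\<close>). So it remains to bound \<open>(1 - P) A\<close> and, by passing to adjoints,
  \<open>A (1 - Q)\<close> (\<open>residual_of_column_projection\<close>).

  Since \<open>C = A(:,J)\<close> has the same rank as \<open>A\<close>, the rows \<open>V\<^sub>J\<close> of the right singular factor have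
  full column rank, \<open>A = C (V\<^sub>J\<^sup>\<dagger>)\<^sup>* V\<^sup>*\<close>, and by submultiplicativity the norm of \<open>(1 - P) A\<close> is at
  most the norm of \<open>(1 - P) C\<close> times that of \<open>V\<^sub>J\<^sup>\<dagger>\<close>. The matrix \<open>C\<close> differs from \<open>C + E\<^sub>J\<close> by
  \<open>E\<^sub>J\<close>, the projection \<open>1 - P\<close> kills the truncation of \<open>C + E\<^sub>J\<close>, and the truncation is a best
  approximation of rank \<open>k\<close>, at least as good as \<open>C\<close>. This gives the factor 2.

  The best approximation property (\<open>truncated_svd_best_approximation\<close>) holds for every unitarily
  invariant norm: Weyl's inequality compares the singular values of the two differences one by
  one (\<open>weyl_low_rank_perturbation\<close>), and the norm of a nonnegative diagonal matrix is monotone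
  in its entries (\<open>nrm_diag_mono\<close>). Underneath lie the spectral theorem for Hermitian matrices
  and the fact that \<open>X Y\<close> and \<open>Y X\<close> have the same nonzero eigenvalues, which makes singular
  values insensitive to adjoints and to isometric factors.
\<close>

notation mat_adjoint ("_\<^sup>H" [1000] 1000)

section \<open>Adjoints and matrices over the scalar field\<close>

lemma adjoint_dim [simp]:
  "dim_row (A\<^sup>H) = dim_col A" "dim_col (A\<^sup>H) = dim_row A"
  by (simp_all add: mat_adjoint_def)

lemma adjoint_carrier [simp, intro]:
  "A \<in> carrier_mat p q \<Longrightarrow> A\<^sup>H \<in> carrier_mat q p"
  by auto

lemma adjoint_index [simp]:
  fixes A :: "complex mat"
  shows "i < dim_col A \<Longrightarrow> j < dim_row A \<Longrightarrow> A\<^sup>H $$ (i, j) = cnj (A $$ (j, i))"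
  by (simp add: mat_adjoint_def mat_of_rows_index conjugate_complex_def)

lemma adjoint_adjoint [simp]:
  fixes A :: "complex mat"
  shows "A\<^sup>H\<^sup>H = A"
  by (rule eq_matI) auto

lemma mult_mat_assoc:
  fixes A B C :: "complex mat"
  shows "dim_col A = dim_row B \<Longrightarrow> dim_col B = dim_row C \<Longrightarrow> A * B * C = A * (B * C)"
  by (rule assoc_mult_mat[of _ "dim_row A" "dim_row B" _ "dim_row C" _ "dim_col C"]) auto

lemma adjoint_mult:
  fixes A B :: "complex mat"
  assumes "dim_col A = dim_row B"
  shows "(A * B)\<^sup>H = B\<^sup>H * A\<^sup>H"
  using assms by (intro eq_matI) (auto simp: scalar_prod_def mult.commute intro!: sum.cong)

lemma adjoint_one [simp]: "(1\<^sub>m n :: complex mat)\<^sup>H = 1\<^sub>m n"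
  by (rule eq_matI) auto

lemma adjoint_add:
  fixes A B :: "complex mat"
  assumes "A \<in> carrier_mat p q" "B \<in> carrier_mat p q"
  shows "(A + B)\<^sup>H = A\<^sup>H + B\<^sup>H"
  using assms by (intro eq_matI) auto

lemma adjoint_minus:
  fixes A B :: "complex mat"
  assumes "A \<in> carrier_mat p q" "B \<in> carrier_mat p q"
  shows "(A - B)\<^sup>H = A\<^sup>H - B\<^sup>H"
  using assms by (intro eq_matI) auto

lemma adjoint_diag:
  "(mat_diag n f)\<^sup>H = mat_diag n (\<lambda>i. cnj (f i))"
  by (rule eq_matI) (auto simp: mat_diag_def)

lemma adjoint_submatrix:
  fixes A :: "complex mat"
  shows "(submatrix A I J)\<^sup>H = submatrix (A\<^sup>H) J I"
  by (rule eq_matI) (auto simp: submatrix_def pick_le)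

lemma submatrix_cols_mult:
  assumes "A \<in> carrier_mat p q" "B \<in> carrier_mat q r"
  shows "submatrix (A * B) UNIV J = A * submatrix B UNIV J"
  using assms
  by (intro eq_matI) (auto simp: submatrix_def pick_le pick_UNIV scalar_prod_def)

text \<open>Cutting out columns is multiplication by a matrix with orthonormal columns, which
  makes selecting columns a special case of composing with an isometry.\<close>

lemma column_selector_isometry:
  "(submatrix (1\<^sub>m n :: complex mat) UNIV J)\<^sup>H * submatrix (1\<^sub>m n) UNIV J
    = 1\<^sub>m (card {j. j < n \<and> j \<in> J})"
proof (rule eq_matI)
  let ?c = "card {j. j < n \<and> j \<in> J}"
  fix i j assume "i < dim_row (1\<^sub>m ?c :: complex mat)" "j < dim_col (1\<^sub>m ?c :: complex mat)"
  then have ij: "i < ?c" "j < ?c" by auto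
  have le: "pick J i < n" "pick J j < n" using ij pick_le by auto
  have "?c \<le> card J" if "finite J"
    using that by (intro card_mono) auto
  then have "i < card J \<or> infinite J" "j < card J \<or> infinite J"
    using ij by auto
  then have "(pick J i = pick J j) = (i = j)"
    using card_pick by metis
  define S where "S = submatrix (1\<^sub>m n :: complex mat) UNIV J"
  have S: "S \<in> carrier_mat n ?c" by (auto simp: S_def dim_submatrix)
  have entry: "S $$ (a, l) = (if a = pick J l then 1 else 0)" if "a < n" "l < ?c" for a l
    using that pick_le[of l n J] by (simp add: S_def submatrix_index pick_UNIV)
  have "(S\<^sup>H * S) $$ (i, j) = (\<Sum>a\<in>{0..<n}. cnj (S $$ (a, i)) * S $$ (a, j))"
    using S ij by (simp add: scalar_prod_def)
  also have "\<dots> = (\<Sum>a\<in>{0..<n}. if a = pick J i then (if pick J i = pick J j then 1 else 0) else 0)"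
    using ij by (intro sum.cong) (auto simp: entry)
  also have "\<dots> = 1\<^sub>m ?c $$ (i, j)"
    using ij le \<open>(pick J i = pick J j) = (i = j)\<close> by simp
  finally show "((submatrix (1\<^sub>m n :: complex mat) UNIV J)\<^sup>H * submatrix (1\<^sub>m n) UNIV J) $$ (i, j)
      = 1\<^sub>m ?c $$ (i, j)" by (simp add: S_def)
qed (auto simp: dim_submatrix)

lemma submatrix_cols_eq_mult:
  fixes A :: "complex mat"
  assumes "A \<in> carrier_mat p q"
  shows "submatrix A UNIV J = A * submatrix (1\<^sub>m q) UNIV J"
  using submatrix_cols_mult[OF assms one_carrier_mat] assms by simp

locale real_or_complex =
  fixes K :: "complex set"
  assumes K: "K = \<real> \<or> K = UNIV"
begin

lemma scalar_closed:
  "0 \<in> K" "1 \<in> K" "complex_of_real r \<in> K"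
  "x \<in> K \<Longrightarrow> y \<in> K \<Longrightarrow> x + y \<in> K" "x \<in> K \<Longrightarrow> y \<in> K \<Longrightarrow> x * y \<in> K"
  "x \<in> K \<Longrightarrow> y \<in> K \<Longrightarrow> x - y \<in> K" "x \<in> K \<Longrightarrow> cnj x \<in> K"
  using K by (auto simp: Reals_cnj_iff)

lemma sum_closed: "(\<And>i. i \<in> T \<Longrightarrow> f i \<in> K) \<Longrightarrow> sum f T \<in> K"
  using K by auto

lemma kmat_iff:
  "B \<in> kmat K p q \<longleftrightarrow> B \<in> carrier_mat p q \<and> (\<forall>i<p. \<forall>j<q. B $$ (i, j) \<in> K)"
  by (auto simp: kmat_def)

lemma kmatD: "B \<in> kmat K p q \<Longrightarrow> B \<in> carrier_mat p q"
  by (simp add: kmat_iff)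

lemma kmat_mult: "A \<in> kmat K p q \<Longrightarrow> B \<in> kmat K q r \<Longrightarrow> A * B \<in> kmat K p r"
  by (auto simp: kmat_iff scalar_prod_def intro!: sum_closed scalar_closed)

lemma kmat_add: "A \<in> kmat K p q \<Longrightarrow> B \<in> kmat K p q \<Longrightarrow> A + B \<in> kmat K p q"
  by (auto simp: kmat_iff intro!: scalar_closed)

lemma kmat_minus: "A \<in> kmat K p q \<Longrightarrow> B \<in> kmat K p q \<Longrightarrow> A - B \<in> kmat K p q"
  by (auto simp: kmat_iff intro!: scalar_closed)

lemma kmat_smult: "c \<in> K \<Longrightarrow> A \<in> kmat K p q \<Longrightarrow> c \<cdot>\<^sub>m A \<in> kmat K p q"
  by (auto simp: kmat_iff intro!: scalar_closed)

lemma kmat_adjoint: "A \<in> kmat K p q \<Longrightarrow> A\<^sup>H \<in> kmat K q p"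
  by (auto simp: kmat_iff intro!: scalar_closed)

lemma kmat_one: "1\<^sub>m n \<in> kmat K n n"
  by (auto simp: kmat_iff scalar_closed)

lemma kmat_zero: "0\<^sub>m p q \<in> kmat K p q"
  by (auto simp: kmat_iff scalar_closed)

lemma kmat_diag: "mat_diag n (\<lambda>i. complex_of_real (f i)) \<in> kmat K n n"
  by (auto simp: kmat_iff mat_diag_def scalar_closed)

lemma kmat_submatrix:
  "A \<in> kmat K p q \<Longrightarrow>
    submatrix A I J \<in> kmat K (card {i. i < p \<and> i \<in> I}) (card {j. j < q \<and> j \<in> J})"
  by (auto simp: kmat_iff dim_submatrix submatrix_index pick_le)

end

section \<open>Singular values and isometries\<close>

lemma char_poly_four_block_upper_right_zero:
  fixes A D :: "'a :: idom mat"
  assumes A: "A \<in> carrier_mat n n" and C: "C \<in> carrier_mat m n" and D: "D \<in> carrier_mat m m"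
  shows "char_poly (four_block_mat A (0\<^sub>m n m) C D) = char_poly A * char_poly D"
proof -
  let ?cm = "\<lambda>M. [:0, 1:] \<cdot>\<^sub>m 1\<^sub>m (dim_row M) + map_mat (\<lambda>a. [:- a:]) M"
  let ?M = "four_block_mat A (0\<^sub>m n m) C D"
  have "?cm ?M = four_block_mat (?cm A) (0\<^sub>m n m) (map_mat (\<lambda>a. [:- a:]) C) (?cm D)"
    by (rule eq_matI, insert A C D, auto simp: one_poly_def)
  moreover have "Determinant.det \<dots> = Determinant.det (?cm A) * Determinant.det (?cm D)"
    by (rule det_four_block_mat_upper_right_zero[OF _ refl]) (use A C D in auto)
  ultimately show ?thesis
    unfolding char_poly_defs using A D by simp
qed

lemma char_poly_zero: "char_poly (0\<^sub>m n n :: 'a :: idom mat) = [:0, 1:] ^ n"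
proof -
  have "diag_mat (0\<^sub>m n n :: 'a mat) = map (\<lambda>i. 0) [0..<n]"
    unfolding diag_mat_def by (auto intro: map_cong)
  then show ?thesis
    by (subst char_poly_upper_triangular[of _ n]) (auto simp: map_replicate_const)
qed

text \<open>Sylvester's identity. The block matrices with rows \<open>(X Y, 0), (Y, 0)\<close> and
  \<open>(0, 0), (Y, Y X)\<close> are conjugate by the shear with off-diagonal block \<open>X\<close>, and the
  characteristic polynomial of each is the product of those of its diagonal blocks.\<close>

lemma char_poly_mult_commute:
  fixes X Y :: "complex mat"
  assumes X: "X \<in> carrier_mat n r" and Y: "Y \<in> carrier_mat r n"
  shows "[:0, 1:] ^ r * char_poly (X * Y) = [:0, 1:] ^ n * char_poly (Y * X)"
proof -
  define M1 where "M1 = four_block_mat (X * Y) (0\<^sub>m n r) Y (0\<^sub>m r r)"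
  define M2 where "M2 = four_block_mat (0\<^sub>m n n) (0\<^sub>m n r) Y (Y * X)"
  define P where "P = four_block_mat (1\<^sub>m n) X (0\<^sub>m r n) (1\<^sub>m r)"
  define N where "N = four_block_mat (1\<^sub>m n) (- X) (0\<^sub>m r n) (1\<^sub>m r)"
  have M: "M1 \<in> carrier_mat (n + r) (n + r)" "M2 \<in> carrier_mat (n + r) (n + r)"
     "P \<in> carrier_mat (n + r) (n + r)" "N \<in> carrier_mat (n + r) (n + r)"
    using X Y by (auto simp: M1_def M2_def P_def N_def)
  have YX: "Y * X \<in> carrier_mat r r" "X * Y \<in> carrier_mat n n" "- X \<in> carrier_mat n r"
    using X Y by auto
  note blocks = X Y YX one_carrier_mat zero_carrier_mat
  have [simp]: "- 0\<^sub>m r r = (0\<^sub>m r r :: complex mat)" by (rule eq_matI) auto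
  have [simp]: "X + - X = 0\<^sub>m n r" using X by (intro eq_matI) auto
  have PN: "P * N = 1\<^sub>m (n + r)"
    unfolding P_def N_def
    by (subst mult_four_block_mat[of _ n n _ r _ r _ _ n _ r])
       (use X Y in \<open>auto\<close>)
  have NP: "N * P = 1\<^sub>m (n + r)"
    unfolding P_def N_def
    by (subst mult_four_block_mat[of _ n n _ r _ r _ _ n _ r])
       (use X Y in \<open>auto\<close>)
  have XYX: "X * (Y * X) = X * Y * X" using X Y by simp
  have "M1 * P = four_block_mat (X * Y) (X * Y * X) Y (Y * X)"
    unfolding P_def M1_def
    by (subst mult_four_block_mat[of _ n n _ r _ r _ _ n _ r])
       (use X Y YX in auto)
  moreover have "P * M2 = four_block_mat (X * Y) (X * Y * X) Y (Y * X)"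
    unfolding P_def M2_def
    by (subst mult_four_block_mat[of _ n n _ r _ r _ _ n _ r])
       (use X Y YX XYX in auto)
  ultimately have "M1 * P = P * M2" by simp
  then have "P * M2 * N = M1 * (P * N)"
    using M by (metis assoc_mult_mat)
  then have "M1 = P * M2 * N"
    using PN M by simp
  then have "similar_mat M1 M2"
    using M PN NP by (intro similar_matI[of _ _ P N "n + r"]) auto
  then have "char_poly M1 = char_poly M2" by (rule char_poly_similar)
  moreover have "char_poly M1 = char_poly (X * Y) * [:0, 1:] ^ r"
    unfolding M1_def by (subst char_poly_four_block_upper_right_zero) (use blocks char_poly_zero in auto)
  moreover have "char_poly M2 = [:0, 1:] ^ n * char_poly (Y * X)"
    unfolding M2_def by (subst char_poly_four_block_upper_right_zero) (use blocks char_poly_zero in auto)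
  ultimately show ?thesis by (simp add: mult.commute)
qed

lemma filter_repeat_mset_zero: "filter_mset (\<lambda>z. z \<noteq> (0::complex)) (repeat_mset r {#0#}) = {#}"
  by (induct r) auto

lemma nonzero_eigenvalues_mult_commute:
  fixes X Y :: "complex mat"
  assumes X: "X \<in> carrier_mat n r" and Y: "Y \<in> carrier_mat r n"
  shows "filter_mset (\<lambda>z. z \<noteq> 0) (proots (char_poly (X * Y)))
       = filter_mset (\<lambda>z. z \<noteq> 0) (proots (char_poly (Y * X)))"
proof -
  have nz: "char_poly (X * Y) \<noteq> 0" "char_poly (Y * X) \<noteq> 0"
    using degree_monic_char_poly[of "X * Y" n] degree_monic_char_poly[of "Y * X" r] X Y by auto
  have x: "proots [:0, 1 :: complex:] = {#0#}"
    using proots_linear_factor[of "0 :: complex"] by simp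
  have eq: "repeat_mset r {#0#} + proots (char_poly (X * Y))
      = repeat_mset n {#0#} + proots (char_poly (Y * X))"
    using arg_cong[OF char_poly_mult_commute[OF X Y], of proots] nz
    by (simp add: proots_mult proots_power x)
  have "filter_mset (\<lambda>z. z \<noteq> 0) (proots (char_poly (X * Y)))
      = filter_mset (\<lambda>z. z \<noteq> 0) (repeat_mset r {#0#} + proots (char_poly (X * Y)))"
    by (simp only: filter_union_mset filter_repeat_mset_zero) simp
  also have "\<dots> = filter_mset (\<lambda>z. z \<noteq> 0) (repeat_mset n {#0#} + proots (char_poly (Y * X)))"
    unfolding eq ..
  also have "\<dots> = filter_mset (\<lambda>z. z \<noteq> 0) (proots (char_poly (Y * X)))"
    by (simp only: filter_union_mset filter_repeat_mset_zero) simp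
  finally show ?thesis .
qed

lemma sing_vals_adjoint:
  assumes "B \<in> carrier_mat p q"
  shows "sing_vals (B\<^sup>H) = sing_vals B"
  unfolding sing_vals_def
  using nonzero_eigenvalues_mult_commute[of "B" p q "B\<^sup>H"] assms by simp

text \<open>The Gram matrix of \<open>W D V\<^sup>*\<close> is \<open>V (D\<^sup>* D V\<^sup>*)\<close>, and swapping the two factors turns it
  into \<open>D\<^sup>* D\<close>.\<close>

lemma sing_vals_isometries:
  assumes W: "W \<in> carrier_mat p r" "W\<^sup>H * W = 1\<^sub>m r"
    and V: "V \<in> carrier_mat q s" "V\<^sup>H * V = 1\<^sub>m s"
    and D: "D \<in> carrier_mat r s"
  shows "sing_vals (W * D * V\<^sup>H) = sing_vals D"
proof -
  define Y where "Y = D\<^sup>H * D * V\<^sup>H"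
  have Y: "Y \<in> carrier_mat s q" using D V by (auto simp: Y_def)
  note dims = carrier_matD[OF W(1)] carrier_matD[OF V(1)] carrier_matD[OF D]
  have "(W * D * V\<^sup>H)\<^sup>H * (W * D * V\<^sup>H) = V * (D\<^sup>H * ((W\<^sup>H * W) * (D * V\<^sup>H)))"
    by (simp add: dims adjoint_mult mult_mat_assoc del: W(2))
  also have "\<dots> = V * Y"
    unfolding W(2) using D V by (simp add: Y_def dims mult_mat_assoc)
  finally have 1: "(W * D * V\<^sup>H)\<^sup>H * (W * D * V\<^sup>H) = V * Y" .
  have 2: "Y * V = D\<^sup>H * D"
    using V D by (simp add: Y_def dims mult_mat_assoc)
  show ?thesis
    unfolding sing_vals_def 1 nonzero_eigenvalues_mult_commute[OF V(1) Y] 2 ..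
qed

section \<open>The spectral theorem and the Gram matrix\<close>

lemma mat_mult_index:
  fixes M N :: "complex mat"
  assumes "i < dim_row M" "j < dim_col N" "dim_col M = dim_row N"
  shows "(M * N) $$ (i, j) = (\<Sum>a<dim_col M. M $$ (i, a) * N $$ (a, j))"
  using assms by (simp add: scalar_prod_def lessThan_atLeast0)

lemma gram_index:
  fixes M :: "complex mat"
  assumes "i < dim_col M" "j < dim_col M"
  shows "(M\<^sup>H * M) $$ (i, j) = (\<Sum>a<dim_row M. cnj (M $$ (a, i)) * M $$ (a, j))"
  using assms by (simp add: scalar_prod_def lessThan_atLeast0)

lemma zero_column_if_gram_zero:
  fixes M :: "complex mat"
  assumes ij: "i < dim_row M" "j < dim_col M" and zero: "(M\<^sup>H * M) $$ (j, j) = 0"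
  shows "M $$ (i, j) = 0"
proof -
  have "complex_of_real (\<Sum>a<dim_row M. (cmod (M $$ (a, j)))\<^sup>2) = 0"
    using zero gram_index[OF ij(2) ij(2)]
    by (simp only: of_real_sum complex_norm_square mult.commute)
  then have "(\<Sum>a<dim_row M. (cmod (M $$ (a, j)))\<^sup>2) = 0" by (simp only: of_real_eq_0_iff)
  then show ?thesis
    using ij by (subst (asm) sum_nonneg_eq_0_iff) auto
qed

lemma gram_in_eigenbasis:
  fixes X :: "complex mat"
  assumes X: "X \<in> carrier_mat p q" and Q: "Q \<in> carrier_mat q q" "Q\<^sup>H * Q = 1\<^sub>m q"
    and D: "D \<in> carrier_mat q q" and gram: "X\<^sup>H * X = Q * D * Q\<^sup>H"
  shows "(X * Q)\<^sup>H * (X * Q) = D"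
proof -
  note dims = carrier_matD[OF X] carrier_matD[OF Q(1)] carrier_matD[OF D]
  have "(X * Q)\<^sup>H * (X * Q) = Q\<^sup>H * (X\<^sup>H * X) * Q"
    by (simp add: adjoint_mult mult_mat_assoc dims)
  also have "\<dots> = (Q\<^sup>H * Q) * D * (Q\<^sup>H * Q)"
    unfolding gram by (simp add: mult_mat_assoc dims del: Q(2))
  finally show ?thesis unfolding Q(2) using D by simp
qed

text \<open>Gram--Schmidt applied to a basis that starts with \<open>v\<close> keeps \<open>v\<close> and returns orthogonal
  vectors; dividing them by their lengths makes the matrix unitary.\<close>

lemma unitary_with_first_column:
  fixes v :: "complex vec"
  assumes v: "v \<in> carrier_vec n" "v \<noteq> 0\<^sub>v n"
  obtains W c where "W \<in> carrier_mat n n" "W\<^sup>H * W = 1\<^sub>m n" "col W 0 = c \<cdot>\<^sub>v v"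
proof -
  interpret cof_vec_space n "TYPE(complex)" .
  define b where "b = basis_completion v"
  define ws where "ws = gram_schmidt n b"
  from basis_completion[OF v, folded b_def]
  have dist_b: "distinct b" and indep: "\<not> lin_dep (set b)" and b: "set b \<subseteq> carrier_vec n"
    and hdb: "hd b = v" and len_b: "length b = n" by auto
  from gram_schmidt_result[OF b dist_b indep refl, folded ws_def]
  have ws: "set ws \<subseteq> carrier_vec n" "corthogonal ws" "length ws = n"
    by (auto simp: len_b)
  have n: "n > 0" using v by (cases n) auto
  with len_b obtain vs where bv: "b = v # vs" using hdb by (cases b) auto
  have hdws: "ws ! 0 = v"
    using gram_schmidt_hd[OF v(1), of vs, folded bv, folded ws_def] ws(3) n by (cases ws) auto
  define l where "l i = sqrt (\<Sum>a<n. (cmod (ws ! i $ a))\<^sup>2)" for i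
  define W where "W = Matrix.mat n n (\<lambda>(a, i). ws ! i $ a / complex_of_real (l i))"
  have W: "W \<in> carrier_mat n n" by (simp add: W_def)
  have wsn: "dim_vec (ws ! i) = n" if "i < n" for i
    using ws that by (metis nth_mem subsetD carrier_vecD)
  have ip: "ws ! i \<bullet>c ws ! j = (\<Sum>a<n. ws ! i $ a * cnj (ws ! j $ a))" if "i < n" "j < n" for i j
    using that wsn by (auto simp: scalar_prod_def conjugate_complex_def lessThan_atLeast0)
  have sq: "complex_of_real ((l i)\<^sup>2) = ws ! i \<bullet>c ws ! i" if "i < n" for i
  proof -
    have "(l i)\<^sup>2 = (\<Sum>a<n. (cmod (ws ! i $ a))\<^sup>2)" by (simp add: l_def sum_nonneg)
    then show ?thesis by (simp only: ip[OF that that] of_real_sum complex_norm_square)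
  qed
  have orth: "(ws ! i \<bullet>c ws ! j = 0) = (i \<noteq> j)" if "i < n" "j < n" for i j
    using ws that by (auto simp: corthogonal_def)
  have "W\<^sup>H * W = 1\<^sub>m n"
  proof (rule eq_matI)
    fix i j assume "i < dim_row (1\<^sub>m n :: complex mat)" "j < dim_col (1\<^sub>m n :: complex mat)"
    then have ij: "i < n" "j < n" by auto
    have "(W\<^sup>H * W) $$ (i, j) = (\<Sum>a<n. ws ! j $ a * cnj (ws ! i $ a) / (l i * l j))"
      using ij by (auto simp: W_def scalar_prod_def lessThan_atLeast0 mult.commute intro!: sum.cong)
    also have "\<dots> = (ws ! j \<bullet>c ws ! i) / (l i * l j)"
      using ij by (simp add: ip sum_divide_distrib)
    also have "\<dots> = (if i = j then 1 else 0)"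
      using orth[of i j] orth[of j i] sq[of i] ij by (auto simp: power2_eq_square)
    finally show "(W\<^sup>H * W) $$ (i, j) = 1\<^sub>m n $$ (i, j)" using ij by simp
  qed (use W in auto)
  moreover have "col W 0 = (1 / complex_of_real (l 0)) \<cdot>\<^sub>v v"
    using W n v hdws by (intro eq_vecI) (auto simp: W_def)
  ultimately show ?thesis using that W by blast
qed

text \<open>Deflation: conjugating by a unitary matrix whose first column is an eigenvector splits
  off a \<open>1 \<times> 1\<close> block, and the Hermitian symmetry clears the rest of the first row. The
  eigenvalues may be listed in any prescribed order.\<close>

lemma hermitian_diagonalization:
  fixes A :: "complex mat"
  assumes "A \<in> carrier_mat n n" "A\<^sup>H = A" "char_poly A = (\<Prod>e\<leftarrow>es. [:- e, 1:])"
  shows "\<exists>U \<in> carrier_mat n n. U\<^sup>H * U = 1\<^sub>m n \<and> A = U * mat_diag n (\<lambda>i. es ! i) * U\<^sup>H"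
  using assms
proof (induction es arbitrary: n A)
  case Nil
  then have "n = 0" using degree_monic_char_poly[of A n] by auto
  then show ?case using Nil by (intro bexI[of _ "1\<^sub>m 0"]) (auto intro!: eq_matI)
next
  case (Cons e es)
  note A = Cons.prems(1)
  have cp: "char_poly A = [:- e, 1:] * (\<Prod>e\<leftarrow>es. [:- e, 1:])" using Cons.prems(3) by simp
  have "eigenvalue A e" unfolding eigenvalue_root_char_poly[OF A] cp by simp
  then obtain v where v: "v \<in> carrier_vec n" "v \<noteq> 0\<^sub>v n" "A *\<^sub>v v = e \<cdot>\<^sub>v v"
    using A by (auto simp: eigenvalue_def eigenvector_def)
  obtain W c where W: "W \<in> carrier_mat n n" "W\<^sup>H * W = 1\<^sub>m n" "col W 0 = c \<cdot>\<^sub>v v"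
    using unitary_with_first_column[OF v(1,2)] .
  have WW: "W * W\<^sup>H = 1\<^sub>m n" using mat_mult_left_right_inverse[OF _ W(1) W(2)] W(1) by auto
  obtain n1 where n: "n = Suc n1" using v by (cases n) auto
  note dims = carrier_matD[OF A] carrier_matD[OF W(1)]
  define B where "B = W\<^sup>H * A * W"
  have B: "B \<in> carrier_mat n n" using A W by (auto simp: B_def)
  have herm: "B\<^sup>H = B"
    using Cons.prems(2) by (simp add: B_def adjoint_mult mult_mat_assoc dims)
  have AB: "A = W * B * W\<^sup>H"
  proof -
    have "W * B * W\<^sup>H = (W * W\<^sup>H) * A * (W * W\<^sup>H)"
      by (simp add: B_def mult_mat_assoc dims)
    then show ?thesis unfolding WW using A by simp
  qed
  have AW: "col (A * W) 0 = e \<cdot>\<^sub>v col W 0"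
  proof -
    have "col (A * W) 0 = A *\<^sub>v col W 0" using col_mult2[OF A W(1)] n by simp
    also have "\<dots> = c \<cdot>\<^sub>v (A *\<^sub>v v)" unfolding W(3) using A v by (simp add: mult_mat_vec)
    also have "\<dots> = e \<cdot>\<^sub>v col W 0" unfolding v(3) W(3) by (simp add: smult_smult_assoc mult.commute)
    finally show ?thesis .
  qed
  have B0: "B $$ (i, 0) = (if i = 0 then e else 0)" if i: "i < n" for i
  proof -
    have "B $$ (i, 0) = row (W\<^sup>H) i \<bullet> col (A * W) 0"
      using i n by (simp add: B_def mult_mat_assoc dims)
    also have "\<dots> = e * (W\<^sup>H * W) $$ (i, 0)"
      unfolding AW using i n by (simp add: dims)
    finally show ?thesis using i n by (simp add: W(2))
  qed
  have B0': "B $$ (0, j) = (if j = 0 then e else 0)" if "j < n" for j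
  proof (cases "j = 0")
    case False
    have "B $$ (0, j) = cnj (B $$ (j, 0))"
      using adjoint_index[of 0 B j] that n B unfolding herm by simp
    then show ?thesis using B0[OF that] False by simp
  qed (use B0 that in auto)
  define A3 where "A3 = Matrix.mat n1 n1 (\<lambda>(i, j). B $$ (Suc i, Suc j))"
  define E1 where "E1 = Matrix.mat 1 1 (\<lambda>_. e)"
  have c: "A3 \<in> carrier_mat n1 n1" "E1 \<in> carrier_mat 1 1" by (auto simp: A3_def E1_def)
  have Bblock: "B = four_block_mat E1 (0\<^sub>m 1 n1) (0\<^sub>m n1 1) A3"
    using B n B0 B0' by (intro eq_matI) (auto simp: A3_def E1_def)
  have "similar_mat B A"
    by (rule similar_matI[of _ _ "W\<^sup>H" W n]) (use A B W WW B_def in auto)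
  then have "char_poly B = char_poly A" by (rule char_poly_similar)
  moreover have "char_poly B = char_poly E1 * char_poly A3"
    unfolding Bblock by (rule char_poly_four_block_upper_right_zero) (use c in auto)
  moreover have "char_poly E1 = [:- e, 1:]"
    by (simp add: E1_def char_poly_defs det_def sign_def)
  ultimately have cp3: "char_poly A3 = (\<Prod>e\<leftarrow>es. [:- e, 1:])"
    using cp by (metis mult_cancel_left pCons_eq_0_iff zero_neq_one)
  have herm3: "A3\<^sup>H = A3"
  proof (rule eq_matI)
    fix i j assume "i < dim_row A3" "j < dim_col A3"
    then have "i < n1" "j < n1" using c by auto
    then show "A3\<^sup>H $$ (i, j) = A3 $$ (i, j)"
      using adjoint_index[of "Suc i" B "Suc j"] B n unfolding herm by (simp add: A3_def)
  qed (use c in auto)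
  obtain U where U: "U \<in> carrier_mat n1 n1" "U\<^sup>H * U = 1\<^sub>m n1"
      "A3 = U * mat_diag n1 (\<lambda>i. es ! i) * U\<^sup>H"
    using Cons.IH[OF c(1) herm3 cp3] by blast
  define D3 where "D3 = mat_diag n1 (\<lambda>i. es ! i)"
  have D3: "D3 \<in> carrier_mat n1 n1" by (simp add: D3_def)
  define T where "T = four_block_mat (1\<^sub>m 1) (0\<^sub>m 1 n1) (0\<^sub>m n1 1) U"
  define D where "D = four_block_mat E1 (0\<^sub>m 1 n1) (0\<^sub>m n1 1) D3"
  have TD: "T \<in> carrier_mat n n" "D \<in> carrier_mat n n"
    using U c D3 n by (auto simp: T_def D_def)
  have T': "T\<^sup>H = four_block_mat (1\<^sub>m 1) (0\<^sub>m 1 n1) (0\<^sub>m n1 1) (U\<^sup>H)"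
    using U by (intro eq_matI) (auto simp: T_def)
  have TT: "T\<^sup>H * T = 1\<^sub>m n"
    unfolding T' unfolding T_def
    by (subst mult_four_block_mat[of _ 1 1 _ n1 _ n1 _ _ 1 _ n1]) (use U n in auto)
  have "T * D = four_block_mat E1 (0\<^sub>m 1 n1) (0\<^sub>m n1 1) (U * D3)"
    unfolding T_def D_def
    by (subst mult_four_block_mat[of _ 1 1 _ n1 _ n1 _ _ 1 _ n1]) (use U c D3 in auto)
  then have "T * D * T\<^sup>H = four_block_mat E1 (0\<^sub>m 1 n1) (0\<^sub>m n1 1) (U * D3 * U\<^sup>H)"
    unfolding T'
    by (simp, subst mult_four_block_mat[of _ 1 1 _ n1 _ n1 _ _ 1 _ n1]) (use U c D3 in auto)
  then have BT: "B = T * D * T\<^sup>H" unfolding Bblock U(3) D3_def by simp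
  have Dd: "D = mat_diag n (\<lambda>i. (e # es) ! i)"
    using n by (intro eq_matI) (auto simp: D_def D3_def E1_def mat_diag_def nth_Cons')
  note dims' = dims carrier_matD[OF TD(1)] carrier_matD[OF TD(2)]
  have "(W * T)\<^sup>H * (W * T) = T\<^sup>H * ((W\<^sup>H * W) * T)"
    by (simp add: adjoint_mult mult_mat_assoc dims' del: W(2))
  also have "\<dots> = 1\<^sub>m n" unfolding W(2) using TD TT by simp
  finally have 1: "(W * T)\<^sup>H * (W * T) = 1\<^sub>m n" .
  have 2: "A = (W * T) * D * (W * T)\<^sup>H"
    unfolding AB BT by (simp add: adjoint_mult mult_mat_assoc dims')
  show ?case
    by (rule bexI[of _ "W * T"]) (use 1 2 Dd W TD in auto)
qed

text \<open>The eigenvalues of \<open>X\<^sup>* X\<close> are real and nonnegative because they are the squared lengths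
  of the columns of \<open>X Q\<close>.\<close>

lemma gram_diagonalization:
  fixes X :: "complex mat"
  assumes X: "X \<in> carrier_mat p q"
  obtains Q \<mu> where "Q \<in> carrier_mat q q" "Q\<^sup>H * Q = 1\<^sub>m q" "Q * Q\<^sup>H = 1\<^sub>m q"
    "X\<^sup>H * X = Q * mat_diag q (\<lambda>i. complex_of_real (\<mu> i)) * Q\<^sup>H"
    "\<And>j. j < q \<Longrightarrow> \<mu> j \<ge> 0" "\<And>i j. i \<le> j \<Longrightarrow> j < q \<Longrightarrow> \<mu> j \<le> \<mu> i"
    "char_poly (X\<^sup>H * X) = (\<Prod>j\<leftarrow>[0..<q]. [:- complex_of_real (\<mu> j), 1:])"
proof -
  have G: "X\<^sup>H * X \<in> carrier_mat q q" using X by auto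
  obtain as where as: "char_poly (X\<^sup>H * X) = (\<Prod>a\<leftarrow>as. [:- a, 1:])" "length as = q"
    using char_poly_factorized[OF G] by blast
  define es where "es = rev (sort_key Re as)"
  have es: "length es = q" "mset es = mset as" using as by (auto simp: es_def)
  have "prod_mset (image_mset (\<lambda>a. [:- a, 1:]) (mset es)) = prod_mset (image_mset (\<lambda>a. [:- a, 1:]) (mset as))"
    using es by simp
  then have cp: "char_poly (X\<^sup>H * X) = (\<Prod>a\<leftarrow>es. [:- a, 1:])"
    unfolding as by (simp flip: mset_map add: prod_mset_prod_list)
  have herm: "(X\<^sup>H * X)\<^sup>H = X\<^sup>H * X" using X by (simp add: adjoint_mult)
  obtain Q where Q: "Q \<in> carrier_mat q q" "Q\<^sup>H * Q = 1\<^sub>m q"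
      "X\<^sup>H * X = Q * mat_diag q (\<lambda>i. es ! i) * Q\<^sup>H"
    using hermitian_diagonalization[OF G herm cp] by blast
  have QQ: "Q * Q\<^sup>H = 1\<^sub>m q" using mat_mult_left_right_inverse[OF _ Q(1) Q(2)] Q(1) by auto
  note dims = carrier_matD[OF X] carrier_matD[OF Q(1)]
  have D: "(X * Q)\<^sup>H * (X * Q) = mat_diag q (\<lambda>i. es ! i)"
    by (rule gram_in_eigenbasis[OF X Q(1,2) mat_diag_dim Q(3)])
  have e: "es ! j = complex_of_real (\<Sum>a<p. (cmod ((X * Q) $$ (a, j)))\<^sup>2)" if "j < q" for j
  proof -
    have "es ! j = ((X * Q)\<^sup>H * (X * Q)) $$ (j, j)" unfolding D using that by (simp add: mat_diag_def)
    also have "\<dots> = (\<Sum>a<p. (X * Q) $$ (a, j) * cnj ((X * Q) $$ (a, j)))"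
      using that by (subst gram_index) (auto simp: dims mult.commute simp del: index_mult_mat(1))
    finally show ?thesis by (simp only: of_real_sum complex_norm_square)
  qed
  define \<mu> where "\<mu> j = Re (es ! j)" for j
  have l: "es ! j = complex_of_real (\<mu> j)" "\<mu> j \<ge> 0" if "j < q" for j
    using e[OF that] by (auto simp: \<mu>_def sum_nonneg)
  have desc: "\<mu> j \<le> \<mu> i" if "i \<le> j" "j < q" for i j
  proof -
    have "sorted (map Re (sort_key Re as))" by simp
    from sorted_nth_mono[OF this, of "q - 1 - j" "q - 1 - i"] show ?thesis
      using that as(2) by (simp add: \<mu>_def es_def rev_nth)
  qed
  have "mat_diag q (\<lambda>i. es ! i) = mat_diag q (\<lambda>i. complex_of_real (\<mu> i))"
    using l by (intro eq_matI) (auto simp: mat_diag_def)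
  moreover have "map (\<lambda>a. [:- a, 1:]) es = map (\<lambda>j. [:- complex_of_real (\<mu> j), 1:]) [0..<q]"
    using es l by (intro nth_equalityI) auto
  ultimately show ?thesis using that[of Q \<mu>] Q QQ l desc cp by simp
qed

text \<open>This has the shape of a list of singular values: the dropped zeros make diagonal matrices
  of different sizes comparable, and the sorting makes the order of the entries irrelevant.\<close>

definition nonzero_desc :: "nat \<Rightarrow> (nat \<Rightarrow> real) \<Rightarrow> real list" where
  "nonzero_desc n f = rev (sorted_list_of_multiset
     (filter_mset (\<lambda>x. x \<noteq> 0) (image_mset f (mset [0..<n]))))"

lemma sing_vals_from_char_poly:
  assumes cp: "char_poly (X\<^sup>H * X) = (\<Prod>j\<leftarrow>[0..<q]. [:- complex_of_real (\<mu> j), 1:])"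
    and nonneg: "\<And>j. j < q \<Longrightarrow> \<mu> j \<ge> 0"
  shows "sing_vals X = nonzero_desc q (\<lambda>j. sqrt (\<mu> j))"
proof -
  have "proots (char_poly (X\<^sup>H * X)) = sum_list (map proots (map (\<lambda>j. [:- complex_of_real (\<mu> j), 1:]) [0..<q]))"
    unfolding cp
    by (subst proots_prod_list[of "map (\<lambda>j. [:- complex_of_real (\<mu> j), 1:]) [0..<q]",
          unfolded list.map_ident]) auto
  also have "\<dots> = image_mset (\<lambda>j. complex_of_real (\<mu> j)) (mset [0..<q])"
    by (induct q) (auto simp: proots_linear_factor)
  finally have pr: "proots (char_poly (X\<^sup>H * X)) = image_mset (\<lambda>j. complex_of_real (\<mu> j)) (mset [0..<q])" .
  show ?thesis
    unfolding sing_vals_def nonzero_desc_def pr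
    by (simp add: filter_mset_image_mset image_mset.compositionality o_def)
qed

lemma sing_vals_diag:
  assumes "\<And>j. j < q \<Longrightarrow> f j \<ge> 0"
  shows "sing_vals (mat_diag q (\<lambda>j. complex_of_real (f j))) = nonzero_desc q f"
proof -
  let ?D = "mat_diag q (\<lambda>j. complex_of_real (f j))"
  have g: "?D\<^sup>H * ?D = mat_diag q (\<lambda>j. complex_of_real ((f j)\<^sup>2))"
    by (simp add: adjoint_diag power2_eq_square)
  have "char_poly (?D\<^sup>H * ?D) = (\<Prod>a\<leftarrow>diag_mat (?D\<^sup>H * ?D). [:- a, 1:])"
    unfolding g by (rule char_poly_upper_triangular[OF mat_diag_dim]) (auto simp: mat_diag_def)
  also have "diag_mat (?D\<^sup>H * ?D) = map (\<lambda>j. complex_of_real ((f j)\<^sup>2)) [0..<q]"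
    unfolding g by (auto simp: diag_mat_def mat_diag_def)
  finally have "char_poly (?D\<^sup>H * ?D) = (\<Prod>j\<leftarrow>[0..<q]. [:- complex_of_real ((f j)\<^sup>2), 1:])"
    by (simp add: o_def)
  from sing_vals_from_char_poly[OF this]
  have "sing_vals ?D = nonzero_desc q (\<lambda>j. sqrt ((f j)\<^sup>2))" by simp
  also have "\<dots> = nonzero_desc q f"
    unfolding nonzero_desc_def using assms by (intro arg_cong[where f = "\<lambda>M. rev (sorted_list_of_multiset (filter_mset _ M))"] image_mset_cong) auto
  finally show ?thesis .
qed

lemma sing_vals_desc:
  assumes "i \<le> j" "j < length (sing_vals B)"
  shows "sing_vals B ! j \<le> sing_vals B ! i"
proof -
  let ?l = "sorted_list_of_multiset (image_mset (\<lambda>z. sqrt (Re z))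
         (filter_mset (\<lambda>z. z \<noteq> 0) (proots (char_poly (B\<^sup>H * B)))))"
  have "sorted ?l" by simp
  from sorted_nth_mono[OF this, of "length ?l - 1 - j" "length ?l - 1 - i"] show ?thesis
    using assms unfolding sing_vals_def by (simp add: rev_nth)
qed

lemma sing_vals_nonneg:
  assumes B: "B \<in> carrier_mat p q" and "x \<in> set (sing_vals B)"
  shows "x \<ge> 0"
proof -
  obtain Q \<mu> where nn: "\<And>j. j < q \<Longrightarrow> \<mu> j \<ge> (0::real)"
    and cp: "char_poly (B\<^sup>H * B) = (\<Prod>j\<leftarrow>[0..<q]. [:- complex_of_real (\<mu> j), 1:])"
    by (rule gram_diagonalization[OF B]) blast
  show ?thesis
    using assms(2) sing_vals_from_char_poly[OF cp nn] nn by (auto simp: nonzero_desc_def)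
qed

section \<open>Rank\<close>

lemma length_nonzero_desc: "length (nonzero_desc n f) = card {j. j < n \<and> f j \<noteq> 0}"
proof -
  have "mset (nonzero_desc n f) = mset (filter (\<lambda>x. x \<noteq> 0) (map f [0..<n]))"
    by (simp add: nonzero_desc_def)
  then have "length (nonzero_desc n f) = length (filter (\<lambda>x. x \<noteq> 0) (map f [0..<n]))"
    by (rule mset_eq_length)
  also have "\<dots> = card {j. j < n \<and> f j \<noteq> 0}"
    unfolding length_filter_conv_card by (intro arg_cong[where f = card]) auto
  finally show ?thesis .
qed

text \<open>The columns of \<open>F G\<close> lie in the span of the columns of \<open>F\<close>.\<close>

lemma (in vec_space) rank_mult_le_left:
  assumes F: "F \<in> carrier_mat n s" and G: "G \<in> carrier_mat s q"
  shows "rank (F * G) \<le> rank F"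
proof -
  let ?T = "set (cols F)"
  have FG: "F * G \<in> carrier_mat n q" using F G by auto
  have T: "?T \<subseteq> carrier_vec n" using cols_dim F by blast
  obtain S where S: "maximal S (\<lambda>T. T \<subseteq> set (cols (F * G)) \<and> lin_indpt T)"
    using maximal_exists[of "\<lambda>T. T \<subseteq> set (cols (F * G)) \<and> lin_indpt T" "card (set (cols (F * G)))" "{}"]
    by (meson List.finite_set card_mono empty_iff empty_subsetI finite_lin_indpt2 rev_finite_subset)
  then have "S \<subseteq> set (cols (F * G))" and li: "lin_indpt S" by (auto simp: maximal_def)
  moreover have "set (cols (F * G)) \<subseteq> span ?T"
  proof
    fix x assume "x \<in> set (cols (F * G))"
    then obtain j where j: "j < q" "x = col (F * G) j"
      using FG by (auto simp: cols_def)
    have "x = F *\<^sub>v col G j" using j col_mult2[OF F G] by simp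
    moreover have "col G j \<in> carrier_vec (dim_col F)" using j F G by auto
    moreover have "x \<in> carrier_vec (dim_row F)" using j F G by auto
    ultimately have "x \<in> col_space F" using col_space_eq[OF F] by blast
    then show "x \<in> span ?T" by (simp add: col_space_def)
  qed
  ultimately have S': "S \<subseteq> span ?T" by blast
  have vs: "vectorspace class_ring (span_vs ?T)"
    using T span_is_subspace subspace_def subspace_is_vs by auto
  have "module.lin_indpt class_ring (span_vs ?T) S"
    using span_li_not_depend(2)[OF S'] li T span_is_submodule by auto
  then have "card S \<le> vectorspace.dim class_ring (span_vs ?T)"
    using S' by (intro vectorspace.li_le_dim(2)[OF vs fin_dim_span_cols[OF F]]) auto
  then show ?thesis
    using rank_card_indpt[OF FG S] by (simp add: rank_def)
qed

lemma mrank_mult_le_left: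
  assumes "F \<in> carrier_mat p s" "G \<in> carrier_mat s q"
  shows "mrank (F * G) \<le> mrank F"
  using vec_space.rank_mult_le_left[OF assms] assms by (simp add: mrank_def)

lemma mrank_le_dim_col: "mrank F \<le> dim_col F"
  unfolding mrank_def by (rule vec_space.rank_le_nc) auto

lemma mrank_left_invertible:
  assumes F: "F \<in> carrier_mat p s" and Y: "Y \<in> carrier_mat s p" and YF: "Y * F = 1\<^sub>m s"
  shows "mrank F = s"
proof -
  interpret vec_space "TYPE(complex)" p .
  have inj: "v = 0\<^sub>v s" if "v \<in> carrier_vec s" "F *\<^sub>v v = 0\<^sub>v p" for v
  proof -
    have "v = (Y * F) *\<^sub>v v" using YF that by simp
    also have "\<dots> = Y *\<^sub>v (F *\<^sub>v v)" using Y F that by simp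
    also have "\<dots> = 0\<^sub>v s" using that Y by (auto intro!: eq_vecI)
    finally show ?thesis .
  qed
  have "distinct (cols F)"
    unfolding distinct_conv_nth
  proof (intro allI impI)
    fix i j assume ij: "i < length (cols F)" "j < length (cols F)" "i \<noteq> j"
    then have ij': "i < s" "j < s" using F by auto
    have "col (Y * F) i = Y *\<^sub>v col F i" "col (Y * F) j = Y *\<^sub>v col F j"
      using col_mult2[OF Y F] ij' by auto
    moreover have "col (Y * F) i $ i \<noteq> col (Y * F) j $ i"
      using ij ij' by (simp add: YF)
    ultimately show "cols F ! i \<noteq> cols F ! j" using ij' F by auto
  qed
  moreover have "lin_indpt (set (cols F))"
    using lin_depE[OF F _ \<open>distinct (cols F)\<close>] inj by metis
  ultimately show ?thesis
    using lin_indpt_full_rank[OF F] F by (simp add: mrank_def)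
qed

text \<open>With \<open>B\<^sup>* B = Q diag(\<mu>) Q\<^sup>*\<close> and \<open>s\<close> positive eigenvalues, the first \<open>s\<close> columns of
  \<open>B Q\<close> are orthogonal and nonzero and the others vanish, so \<open>B\<close> and these columns have
  the same rank.\<close>

lemma mrank_eq_length_sing_vals:
  assumes B: "B \<in> carrier_mat p q"
  shows "mrank B = length (sing_vals B)"
proof -
  obtain Q \<mu> where Q: "Q \<in> carrier_mat q q" "Q\<^sup>H * Q = 1\<^sub>m q" "Q * Q\<^sup>H = 1\<^sub>m q"
    and G: "B\<^sup>H * B = Q * mat_diag q (\<lambda>i. complex_of_real (\<mu> i)) * Q\<^sup>H"
    and nn: "\<And>j. j < q \<Longrightarrow> \<mu> j \<ge> 0" and desc: "\<And>i j. i \<le> j \<Longrightarrow> j < q \<Longrightarrow> \<mu> j \<le> \<mu> i"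
    and cp: "char_poly (B\<^sup>H * B) = (\<Prod>j\<leftarrow>[0..<q]. [:- complex_of_real (\<mu> j), 1:])"
    by (rule gram_diagonalization[OF B]) blast
  define T where "T = {j. j < q \<and> \<mu> j \<noteq> 0}"
  define s where "s = card T"
  have T: "T = {..<s}"
  proof -
    have down: "i \<in> T" if "j \<in> T" "i \<le> j" for i j
      using that desc[of i j] nn[of j] by (auto simp: T_def)
    have "T \<subseteq> {..<q}" by (auto simp: T_def)
    then have fin: "finite T" by (rule finite_subset) simp
    show ?thesis
    proof (cases "T = {}")
      case True then show ?thesis by (simp add: s_def)
    next
      case False
      then have "Max T \<in> T" using fin by simp
      then have "i \<in> T \<longleftrightarrow> i \<le> Max T" for i using down Max_ge[OF fin] by blast
      then obtain M where "T = {..M}" by blast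
      then show ?thesis unfolding s_def by (simp add: lessThan_Suc_atMost)
    qed
  qed
  have sq: "s \<le> q" unfolding s_def T_def by (rule order_trans[OF card_mono[of "{..<q}"]]) auto
  have pos: "\<mu> j > 0" if "j < s" for j
  proof -
    have "j \<in> T" unfolding T using that by simp
    then show ?thesis using nn[of j] by (simp add: T_def)
  qed
  have zero: "\<mu> j = 0" if "s \<le> j" "j < q" for j
  proof -
    have "j \<notin> T" unfolding T using that by simp
    then show ?thesis using that by (simp add: T_def)
  qed
  have len: "length (sing_vals B) = s"
  proof -
    have "length (sing_vals B) = card {j. j < q \<and> sqrt (\<mu> j) \<noteq> 0}"
      by (subst sing_vals_from_char_poly[OF cp]) (auto simp: nn length_nonzero_desc)
    also have "\<dots> = s" by (simp add: s_def T_def)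
    finally show ?thesis .
  qed
  define L where "L = Matrix.mat q s (\<lambda>(i, j). if i = j then 1 else 0 :: complex)"
  define F where "F = B * (Q * L)"
  have L: "L \<in> carrier_mat q s" by (simp add: L_def)
  have F: "F \<in> carrier_mat p s" using B Q L by (auto simp: F_def)
  note dims = carrier_matD[OF B] carrier_matD[OF Q(1)] carrier_matD[OF L]
    carrier_matD[OF mat_diag_dim[of q "\<lambda>i. complex_of_real (\<mu> i)"]]
  define D where "D = mat_diag q (\<lambda>i. complex_of_real (\<mu> i))"
  have D: "D \<in> carrier_mat q q" by (simp add: D_def)
  have GBQ: "(B * Q)\<^sup>H * (B * Q) = D"
    by (rule gram_in_eigenbasis[OF B Q(1,2) D]) (simp add: G D_def)
  have "F\<^sup>H * F = L\<^sup>H * ((B * Q)\<^sup>H * (B * Q)) * L"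
    by (simp add: F_def adjoint_mult mult_mat_assoc dims)
  also have "\<dots> = L\<^sup>H * (D * L)"
    unfolding GBQ by (simp add: mult_mat_assoc carrier_matD[OF D] dims)
  also have "D * L = Matrix.mat q s (\<lambda>(i, j). if i = j then complex_of_real (\<mu> i) else 0)"
    unfolding D_def mat_diag_mult_left[OF L] by (rule eq_matI) (auto simp: L_def)
  also have "L\<^sup>H * \<dots> = mat_diag s (\<lambda>i. complex_of_real (\<mu> i))"
  proof (rule eq_matI)
    fix i j assume "i < dim_row (mat_diag s (\<lambda>i. complex_of_real (\<mu> i)))"
      "j < dim_col (mat_diag s (\<lambda>i. complex_of_real (\<mu> i)))"
    then have ij: "i < s" "j < s" by (auto simp: mat_diag_def)
    have "(L\<^sup>H * Matrix.mat q s (\<lambda>(i, j). if i = j then complex_of_real (\<mu> i) else 0)) $$ (i, j)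
       = (\<Sum>a\<in>{0..<q}. cnj (L $$ (a, i)) * (if a = j then complex_of_real (\<mu> a) else 0))"
      using ij by (simp add: scalar_prod_def dims)
    also have "\<dots> = (\<Sum>a\<in>{0..<q}. if a = i then (if i = j then complex_of_real (\<mu> i) else 0) else 0)"
      using ij by (intro sum.cong) (auto simp: L_def)
    finally have "(L\<^sup>H * Matrix.mat q s (\<lambda>(i, j). if i = j then complex_of_real (\<mu> i) else 0)) $$ (i, j)
       = \<dots>" .
    then show "(L\<^sup>H * Matrix.mat q s (\<lambda>(i, j). if i = j then complex_of_real (\<mu> i) else 0)) $$ (i, j)
       = mat_diag s (\<lambda>i. complex_of_real (\<mu> i)) $$ (i, j)"
      using ij sq by (simp add: mat_diag_def)
  qed (auto simp: L_def mat_diag_def)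
  finally have FF: "F\<^sup>H * F = mat_diag s (\<lambda>i. complex_of_real (\<mu> i))" .
  let ?R = "mat_diag s (\<lambda>i. complex_of_real (inverse (\<mu> i)))"
  have nz: "\<mu> j \<noteq> 0" if "j < s" for j using pos[OF that] by simp
  have "?R * F\<^sup>H * F = ?R * (F\<^sup>H * F)"
    using F by (simp add: mult_mat_assoc mat_diag_def)
  also have "\<dots> = 1\<^sub>m s"
    unfolding FF mat_diag_diag using nz by (intro eq_matI) (auto simp: mat_diag_def)
  finally have inv: "?R * F\<^sup>H * F = 1\<^sub>m s" .
  have "mrank F = s"
    by (rule mrank_left_invertible[OF F _ inv]) (use F in \<open>auto intro!: mult_carrier_mat\<close>)
  moreover have "mrank F \<le> mrank B"
    unfolding F_def by (rule mrank_mult_le_left[OF B]) (use Q L in auto)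
  moreover have "mrank B \<le> s"
  proof -
    have BQ: "B * Q = F * L\<^sup>H"
    proof (rule eq_matI)
      fix i j assume "i < dim_row (F * L\<^sup>H)" "j < dim_col (F * L\<^sup>H)"
      then have ij: "i < p" "j < q" using F L by auto
      have FBQ: "F $$ (i, a) = (B * Q) $$ (i, a)" if "a < s" for a
      proof -
        have "F = (B * Q) * L" by (simp add: F_def mult_mat_assoc dims)
        then have "F $$ (i, a) = (\<Sum>b\<in>{0..<q}. (B * Q) $$ (i, b) * L $$ (b, a))"
          using ij that mat_mult_index[of i "B * Q" a L] by (simp add: dims lessThan_atLeast0 del: index_mult_mat(1))
        also have "\<dots> = (\<Sum>b\<in>{0..<q}. if b = a then (B * Q) $$ (i, a) else 0)"
          using that by (intro sum.cong) (auto simp: L_def)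
        finally show ?thesis using that sq by simp
      qed
      have "(F * L\<^sup>H) $$ (i, j) = (\<Sum>a\<in>{0..<s}. F $$ (i, a) * cnj (L $$ (j, a)))"
        using ij F L by (simp add: scalar_prod_def)
      also have "\<dots> = (\<Sum>a\<in>{0..<s}. if a = j then (B * Q) $$ (i, j) else 0)"
        using ij by (intro sum.cong) (auto simp: L_def FBQ)
      also have "\<dots> = (B * Q) $$ (i, j)"
      proof (cases "j < s")
        case False
        have "D $$ (j, j) = 0" using zero[of j] False ij by (simp add: D_def mat_diag_def)
        then have "(B * Q) $$ (i, j) = 0"
          using ij by (intro zero_column_if_gram_zero[of i "B * Q" j, unfolded GBQ]) (auto simp: dims simp del: index_mult_mat(1))
        then show ?thesis using False by (auto intro: sum.neutral)
      qed simp
      finally show "(B * Q) $$ (i, j) = (F * L\<^sup>H) $$ (i, j)" by simp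
    qed (use F L B Q in auto)
    have "B = B * (Q * Q\<^sup>H)" unfolding Q(3) using B by simp
    also have "\<dots> = (B * Q) * Q\<^sup>H" by (simp add: mult_mat_assoc dims)
    also have "\<dots> = F * (L\<^sup>H * Q\<^sup>H)"
      unfolding BQ by (simp add: mult_mat_assoc dims carrier_matD[OF F])
    finally have "B = F * (L\<^sup>H * Q\<^sup>H)" .
    then have "mrank B \<le> mrank F"
      using mrank_mult_le_left[OF F, of "L\<^sup>H * Q\<^sup>H" q]
        mult_carrier_mat[OF adjoint_carrier[OF L] adjoint_carrier[OF Q(1)]] by simp
    then show ?thesis using \<open>mrank F = s\<close> by simp
  qed
  ultimately show ?thesis using len by simp
qed

lemma mrank_adjoint: "mrank (B\<^sup>H) = mrank B"
  using mrank_eq_length_sing_vals[of B "dim_row B" "dim_col B"]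
    mrank_eq_length_sing_vals[of "B\<^sup>H" "dim_col B" "dim_row B"]
    sing_vals_adjoint[of B "dim_row B" "dim_col B"] by auto

text \<open>All eigenvalues of \<open>F\<^sup>* F\<close> are nonzero, since as many singular values as columns survive;
  the left inverse is \<open>(F\<^sup>* F)\<^sup>-\<^sup>1 F\<^sup>*\<close>.\<close>

lemma full_column_rank_left_inverse:
  assumes F: "F \<in> carrier_mat p s" and rank: "mrank F = s"
  obtains Y where "Y \<in> carrier_mat s p" "Y * F = 1\<^sub>m s"
proof -
  obtain Q \<mu> where Q: "Q \<in> carrier_mat s s" "Q\<^sup>H * Q = 1\<^sub>m s" "Q * Q\<^sup>H = 1\<^sub>m s"
    and G: "F\<^sup>H * F = Q * mat_diag s (\<lambda>i. complex_of_real (\<mu> i)) * Q\<^sup>H"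
    and nn: "\<And>j. j < s \<Longrightarrow> \<mu> j \<ge> 0"
    and cp: "char_poly (F\<^sup>H * F) = (\<Prod>j\<leftarrow>[0..<s]. [:- complex_of_real (\<mu> j), 1:])"
    by (rule gram_diagonalization[OF F]) blast
  have "card {j. j < s \<and> sqrt (\<mu> j) \<noteq> 0} = s"
    using rank sing_vals_from_char_poly[OF cp] nn
    by (simp only: mrank_eq_length_sing_vals[OF F] length_nonzero_desc)
  then have "{j. j < s \<and> sqrt (\<mu> j) \<noteq> 0} = {..<s}"
    by (intro card_subset_eq) auto
  then have nz: "\<mu> j \<noteq> 0" if "j < s" for j using that by (auto simp: set_eq_iff)
  define D where "D = mat_diag s (\<lambda>i. complex_of_real (\<mu> i))"
  define R where "R = mat_diag s (\<lambda>i. complex_of_real (inverse (\<mu> i)))"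
  have c: "D \<in> carrier_mat s s" "R \<in> carrier_mat s s" by (auto simp: D_def R_def)
  have RD: "R * D = 1\<^sub>m s"
    unfolding R_def D_def mat_diag_diag using nz by (intro eq_matI) (auto simp: mat_diag_def)
  note dims = carrier_matD[OF F] carrier_matD[OF Q(1)] carrier_matD[OF c(1)] carrier_matD[OF c(2)]
  have "Q * R * Q\<^sup>H * F\<^sup>H * F = Q * (R * (Q\<^sup>H * (F\<^sup>H * F)))"
    by (simp add: mult_mat_assoc dims)
  also have "\<dots> = Q * (R * ((Q\<^sup>H * Q) * (D * Q\<^sup>H)))"
    unfolding G D_def[symmetric] by (simp add: mult_mat_assoc dims del: Q(2))
  also have "\<dots> = Q * (R * D * Q\<^sup>H)"
    unfolding Q(2) using c Q(1) by (simp add: mult_mat_assoc dims)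
  also have "\<dots> = 1\<^sub>m s" unfolding RD using Q by simp
  finally show ?thesis
    by (rule that[rotated]) (use Q c F in \<open>auto intro!: mult_carrier_mat\<close>)
qed

section \<open>The pseudoinverse\<close>

text \<open>Two pseudoinverses induce the same orthogonal projections \<open>B X = B Y\<close> and \<open>X B = Y B\<close>.\<close>

lemma is_pinv_unique:
  assumes X: "is_pinv B X" and Y: "is_pinv B Y"
  shows "X = Y"
proof -
  note x = X[unfolded is_pinv_def] and y = Y[unfolded is_pinv_def]
  have c: "X \<in> carrier_mat (dim_col B) (dim_row B)" "Y \<in> carrier_mat (dim_col B) (dim_row B)"
    using x y by auto
  note dims = carrier_matD[OF c(1)] carrier_matD[OF c(2)]
  have BXY: "B * X = B * Y"
  proof -
    have "B * X = (B * X)\<^sup>H" using x by simp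
    also have "\<dots> = ((B * Y) * (B * X))\<^sup>H" using y by (simp add: dims flip: mult_mat_assoc)
    also have "\<dots> = (B * X)\<^sup>H * (B * Y)\<^sup>H" by (rule adjoint_mult) (simp add: dims)
    also have "\<dots> = B * X * (B * Y)" using x y by simp
    also have "\<dots> = B * Y" using x by (simp add: dims flip: mult_mat_assoc)
    finally show ?thesis .
  qed
  have XYB: "X * B = Y * B"
  proof -
    have "X * B = (X * B)\<^sup>H" using x by simp
    also have "\<dots> = ((X * B) * (Y * B))\<^sup>H" using y by (simp add: dims mult_mat_assoc)
    also have "\<dots> = (Y * B)\<^sup>H * (X * B)\<^sup>H" by (rule adjoint_mult) (simp add: dims)
    also have "\<dots> = Y * B * (X * B)" using x y by simp
    also have "\<dots> = Y * B" using x by (simp add: dims mult_mat_assoc)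
    finally show ?thesis .
  qed
  have "X = X * (B * X)" using x by (simp add: dims mult_mat_assoc)
  also have "\<dots> = X * B * Y" unfolding BXY by (simp add: dims mult_mat_assoc)
  also have "\<dots> = Y" unfolding XYB using y by simp
  finally show ?thesis .
qed

text \<open>The witness is \<open>M\<^sup>+ B\<^sup>*\<close>, where \<open>M = B\<^sup>* B\<close> is diagonalised and \<open>M\<^sup>+\<close> inverts its nonzero
  eigenvalues. That \<open>B M\<^sup>+ M = B\<close> holds because \<open>B Q\<close> has vanishing columns wherever the
  eigenvalue vanishes.\<close>

lemma is_pinv_exists: "\<exists>X. is_pinv B X"
proof -
  define p q where "p = dim_row B" and "q = dim_col B"
  have B: "B \<in> carrier_mat p q" by (auto simp: p_def q_def)
  obtain Q \<mu> where Q: "Q \<in> carrier_mat q q" "Q\<^sup>H * Q = 1\<^sub>m q" "Q * Q\<^sup>H = 1\<^sub>m q"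
    and G: "B\<^sup>H * B = Q * mat_diag q (\<lambda>i. complex_of_real (\<mu> i)) * Q\<^sup>H"
    by (rule gram_diagonalization[OF B])
  define D where "D = mat_diag q (\<lambda>i. complex_of_real (\<mu> i))"
  define R where "R = mat_diag q (\<lambda>i. complex_of_real (inverse (\<mu> i)))"
  have c: "D \<in> carrier_mat q q" "R \<in> carrier_mat q q" by (auto simp: D_def R_def)
  have sa: "R\<^sup>H = R" "D\<^sup>H = D" by (simp_all add: R_def D_def adjoint_diag)
  define N where "N = Q * R * Q\<^sup>H"
  have N: "N \<in> carrier_mat q q" using Q c by (auto simp: N_def)
  note dims = carrier_matD[OF B] carrier_matD[OF Q(1)] carrier_matD[OF c(1)] carrier_matD[OF c(2)]
     carrier_matD[OF N]
  have NH: "N\<^sup>H = N" by (simp add: N_def adjoint_mult mult_mat_assoc dims sa)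
  have RDR: "R * D * R = R"
  proof -
    have "inverse (complex_of_real x) * complex_of_real x * inverse (complex_of_real x)
        = inverse (complex_of_real x)" for x
      by (cases "x = 0") auto
    then show ?thesis by (simp only: R_def D_def mat_diag_diag of_real_inverse)
  qed
  have BQRD: "B * Q * (R * D) = B * Q"
  proof -
    have BQ: "B * Q \<in> carrier_mat p q" using B Q by auto
    have RD: "R * D = mat_diag q (\<lambda>i. complex_of_real (inverse (\<mu> i) * \<mu> i))"
      by (simp add: R_def D_def)
    have GBQ: "(B * Q)\<^sup>H * (B * Q) = D"
      by (rule gram_in_eigenbasis[OF B Q(1,2) c(1)]) (simp add: G D_def)
    have col0: "(B * Q) $$ (i, j) = 0" if "i < p" "j < q" "\<mu> j = 0" for i j
    proof -
      have "D $$ (j, j) = 0" using that by (simp add: D_def mat_diag_def)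
      then show ?thesis
        using that by (intro zero_column_if_gram_zero[of i "B * Q" j, unfolded GBQ]) (auto simp: dims simp del: index_mult_mat(1))
    qed
    show ?thesis
      unfolding RD mat_diag_mult_right[OF BQ]
    proof (rule eq_matI)
      fix i j assume "i < dim_row (B * Q)" "j < dim_col (B * Q)"
      then have "i < p" "j < q" using BQ by (auto simp: dims)
      then show "Matrix.mat p q (\<lambda>(i, j). (B * Q) $$ (i, j) * complex_of_real (inverse (\<mu> j) * \<mu> j)) $$ (i, j)
          = (B * Q) $$ (i, j)"
        using col0[of i j] by (cases "\<mu> j = 0") (auto simp del: index_mult_mat(1))
    qed (auto simp: dims)
  qed
  have NGN: "N * (B\<^sup>H * B) * N = N"
  proof -
    have "N * (B\<^sup>H * B) * N = Q * (R * ((Q\<^sup>H * Q) * (D * ((Q\<^sup>H * Q) * (R * Q\<^sup>H)))))"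
      unfolding G D_def[symmetric] by (simp add: N_def mult_mat_assoc dims del: Q(2))
    also have "\<dots> = Q * (R * D * R) * Q\<^sup>H"
      unfolding Q(2) using c Q(1) by (simp add: mult_mat_assoc dims)
    finally show ?thesis unfolding RDR N_def .
  qed
  have BNG: "B * N * (B\<^sup>H * B) = B"
  proof -
    have "B * N * (B\<^sup>H * B) = B * (Q * (R * ((Q\<^sup>H * Q) * (D * Q\<^sup>H))))"
      unfolding G D_def[symmetric] by (simp add: N_def mult_mat_assoc dims del: Q(2))
    also have "\<dots> = B * Q * (R * D) * Q\<^sup>H"
      unfolding Q(2) using c Q(1) by (simp add: mult_mat_assoc dims)
    also have "\<dots> = B" unfolding BQRD using B Q by (simp add: mult_mat_assoc dims)
    finally show ?thesis .
  qed
  have GN: "(B\<^sup>H * B) * N = N * (B\<^sup>H * B)"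
  proof -
    have "(B\<^sup>H * B) * N = Q * (D * ((Q\<^sup>H * Q) * (R * Q\<^sup>H)))"
      unfolding G D_def[symmetric] by (simp add: N_def mult_mat_assoc dims del: Q(2))
    moreover have "N * (B\<^sup>H * B) = Q * (R * ((Q\<^sup>H * Q) * (D * Q\<^sup>H)))"
      unfolding G D_def[symmetric] by (simp add: N_def mult_mat_assoc dims del: Q(2))
    moreover have "R * D = D * R" by (simp add: R_def D_def mult.commute)
    moreover have "D * (R * Q\<^sup>H) = D * R * Q\<^sup>H" "R * (D * Q\<^sup>H) = R * D * Q\<^sup>H"
      by (simp_all add: mult_mat_assoc dims)
    ultimately show ?thesis unfolding Q(2) using c Q(1) by simp
  qed
  have "is_pinv B (N * B\<^sup>H)"
    unfolding is_pinv_def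
  proof (intro conjI)
    show "N * B\<^sup>H \<in> carrier_mat (dim_col B) (dim_row B)" using N B by auto
    show "B * (N * B\<^sup>H) * B = B" using BNG by (simp add: mult_mat_assoc dims)
    have "N * B\<^sup>H * B * (N * B\<^sup>H) = (N * (B\<^sup>H * B) * N) * B\<^sup>H" by (simp add: mult_mat_assoc dims)
    then show "N * B\<^sup>H * B * (N * B\<^sup>H) = N * B\<^sup>H" unfolding NGN .
    show "(B * (N * B\<^sup>H))\<^sup>H = B * (N * B\<^sup>H)" by (simp add: adjoint_mult mult_mat_assoc dims NH)
    have "(N * (B\<^sup>H * B))\<^sup>H = N * (B\<^sup>H * B)" using GN by (simp add: adjoint_mult dims NH)
    then show "(N * B\<^sup>H * B)\<^sup>H = N * B\<^sup>H * B" by (simp add: mult_mat_assoc dims)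
  qed
  then show ?thesis by blast
qed

lemma is_pinv_pinv: "is_pinv B (pinv B)"
  unfolding pinv_def using is_pinv_exists is_pinv_unique by (metis theI')

lemma pinv_eqI: "is_pinv B X \<Longrightarrow> pinv B = X"
  using is_pinv_pinv is_pinv_unique by blast

lemma pinv_adjoint: "pinv (B\<^sup>H) = (pinv B)\<^sup>H"
proof (rule pinv_eqI)
  note x = is_pinv_pinv[of B, unfolded is_pinv_def]
  then have c: "pinv B \<in> carrier_mat (dim_col B) (dim_row B)" by blast
  note dims = carrier_matD[OF c]
  show "is_pinv (B\<^sup>H) ((pinv B)\<^sup>H)"
    unfolding is_pinv_def
  proof (intro conjI)
    have "B\<^sup>H * (pinv B)\<^sup>H * B\<^sup>H = (B * pinv B * B)\<^sup>H"
      by (simp add: adjoint_mult mult_mat_assoc dims)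
    then show "B\<^sup>H * (pinv B)\<^sup>H * B\<^sup>H = B\<^sup>H" using x by simp
    have "(pinv B)\<^sup>H * B\<^sup>H * (pinv B)\<^sup>H = (pinv B * B * pinv B)\<^sup>H"
      by (simp add: adjoint_mult mult_mat_assoc dims)
    then show "(pinv B)\<^sup>H * B\<^sup>H * (pinv B)\<^sup>H = (pinv B)\<^sup>H" using x by simp
    show "(B\<^sup>H * (pinv B)\<^sup>H)\<^sup>H = B\<^sup>H * (pinv B)\<^sup>H" "((pinv B)\<^sup>H * B\<^sup>H)\<^sup>H = (pinv B)\<^sup>H * B\<^sup>H"
      using x by (simp_all add: dims flip: adjoint_mult)
  qed (use c in auto)
qed

text \<open>Entrywise conjugation preserves the Penrose equations, so the pseudoinverse of a real
  matrix is its own conjugate.\<close>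

lemma (in real_or_complex) kmat_pinv:
  assumes B: "B \<in> kmat K p q"
  shows "pinv B \<in> kmat K q p"
proof -
  note Bc = kmatD[OF B]
  note x = is_pinv_pinv[of B, unfolded is_pinv_def]
  then have c: "pinv B \<in> carrier_mat q p" using Bc by auto
  show ?thesis
  proof (cases "K = UNIV")
    case True then show ?thesis using c kmat_iff by blast
  next
    case False
    then have KR: "K = \<real>" using K by blast
    define cj where "cj = map_mat cnj"
    have mult: "cj (M * N) = cj M * cj N" if "dim_col M = dim_row N" for M N
      using that by (intro eq_matI) (auto simp: cj_def scalar_prod_def)
    have adj: "cj (M\<^sup>H) = (cj M)\<^sup>H" for M
      by (intro eq_matI) (auto simp: cj_def)
    have cd: "dim_row (cj M) = dim_row M" "dim_col (cj M) = dim_col M" for M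
      by (auto simp: cj_def)
    have BB: "cj B = B"
    proof -
      have "\<forall>i<p. \<forall>j<q. B $$ (i, j) \<in> \<real>" using B[unfolded kmat_iff] unfolding KR by blast
      then show ?thesis using Bc by (intro eq_matI) (auto simp: cj_def Reals_cnj_iff)
    qed
    note dims = carrier_matD[OF c] carrier_matD[OF Bc]
    have "is_pinv (cj B) (cj (pinv B))"
      unfolding is_pinv_def
    proof (intro conjI)
      show "cj (pinv B) \<in> carrier_mat (dim_col (cj B)) (dim_row (cj B))"
        using cd dims by (intro carrier_matI) auto
      have "cj B * cj (pinv B) * cj B = cj (B * pinv B * B)" by (simp add: mult dims)
      then show "cj B * cj (pinv B) * cj B = cj B" using x by simp
      have "cj (pinv B) * cj B * cj (pinv B) = cj (pinv B * B * pinv B)" by (simp add: mult dims)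
      then show "cj (pinv B) * cj B * cj (pinv B) = cj (pinv B)" using x by simp
      have h: "(B * pinv B)\<^sup>H = B * pinv B" "(pinv B * B)\<^sup>H = pinv B * B" using x by blast+
      have m: "cj B * cj (pinv B) = cj (B * pinv B)" "cj (pinv B) * cj B = cj (pinv B * B)"
        by (simp_all add: mult dims)
      show "(cj B * cj (pinv B))\<^sup>H = cj B * cj (pinv B)" "(cj (pinv B) * cj B)\<^sup>H = cj (pinv B) * cj B"
        unfolding m adj[symmetric] h by (rule refl)+
    qed
    then have "pinv B = cj (pinv B)"
      unfolding BB by (rule pinv_eqI)
    then have "pinv B $$ (i, j) = cj (pinv B) $$ (i, j)" for i j by metis
    then have "cnj (pinv B $$ (i, j)) = pinv B $$ (i, j)" if "i < q" "j < p" for i j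
      using that dims by (metis cj_def index_map_mat(1))
    then show ?thesis using c unfolding kmat_iff unfolding KR by (simp add: Reals_cnj_iff)
  qed
qed

section \<open>Weyl's inequality for low-rank perturbations\<close>

text \<open>Padding \<open>M\<close> with zero rows gives a singular square matrix.\<close>

lemma wide_matrix_kernel:
  fixes M :: "complex mat"
  assumes M: "M \<in> carrier_mat p q" and pq: "p < q"
  obtains y where "y \<in> carrier_mat q 1" "y \<noteq> 0\<^sub>m q 1" "M * y = 0\<^sub>m p 1"
proof -
  define N where "N = Matrix.mat q q (\<lambda>(i, j). if i < p then M $$ (i, j) else 0)"
  have N: "N \<in> carrier_mat q q" by (simp add: N_def)
  have "N\<^sup>T *\<^sub>v unit_vec q p = 0\<^sub>v q"
    using pq by (intro eq_vecI) (auto simp: N_def)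
  moreover have "unit_vec q p \<noteq> (0\<^sub>v q :: complex vec)" using pq by simp
  ultimately have "Determinant.det (N\<^sup>T) = 0"
    using det_0_iff_vec_prod_zero[of "N\<^sup>T" q] N by (metis transpose_carrier_mat unit_vec_carrier)
  then have "Determinant.det N = 0" using det_transpose[OF N] by simp
  then obtain v where v: "v \<in> carrier_vec q" "v \<noteq> 0\<^sub>v q" "N *\<^sub>v v = 0\<^sub>v q"
    using det_0_iff_vec_prod_zero[OF N] by blast
  define y where "y = Matrix.mat q 1 (\<lambda>(i, j). v $ i)"
  have y: "y \<in> carrier_mat q 1" by (simp add: y_def)
  obtain i where i: "i < q" "v $ i \<noteq> 0" using v by (auto simp: vec_eq_iff)
  then have "y $$ (i, 0) \<noteq> (0\<^sub>m q 1) $$ (i, 0)" by (simp add: y_def)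
  then have "y \<noteq> 0\<^sub>m q 1" by metis
  moreover have "M * y = 0\<^sub>m p 1"
  proof (rule eq_matI)
    fix i j assume ij: "i < dim_row (0\<^sub>m p 1 :: complex mat)" "j < dim_col (0\<^sub>m p 1 :: complex mat)"
    then have "(N *\<^sub>v v) $ i = (\<Sum>a\<in>{0..<q}. M $$ (i, a) * v $ a)"
      using pq v(1) by (auto simp: N_def scalar_prod_def)
    moreover have "(M * y) $$ (i, j) = (\<Sum>a<q. M $$ (i, a) * v $ a)"
      using ij M y by (subst mat_mult_index) (auto simp: y_def)
    ultimately show "(M * y) $$ (i, j) = 0\<^sub>m p 1 $$ (i, j)"
      using v(3) ij pq by (simp add: lessThan_atLeast0)
  qed (use M y in auto)
  ultimately show ?thesis using that y by blast
qed

lemma quadratic_form_diag: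
  assumes z: "z \<in> carrier_mat q 1"
  shows "(z\<^sup>H * mat_diag q (\<lambda>i. complex_of_real (\<mu> i)) * z) $$ (0, 0)
       = complex_of_real (\<Sum>a<q. \<mu> a * (cmod (z $$ (a, 0)))\<^sup>2)"
proof -
  let ?D = "mat_diag q (\<lambda>i. complex_of_real (\<mu> i))"
  have "z\<^sup>H * ?D \<in> carrier_mat 1 q" using z mult_carrier_mat[OF adjoint_carrier[OF z] mat_diag_dim] by simp
  then have "(z\<^sup>H * ?D * z) $$ (0, 0) = (\<Sum>a<q. (z\<^sup>H * ?D) $$ (0, a) * z $$ (a, 0))"
    using z by (subst mat_mult_index) auto
  also have "\<dots> = (\<Sum>a<q. complex_of_real (\<mu> a) * (z $$ (a, 0) * cnj (z $$ (a, 0))))"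
    using z unfolding mat_diag_mult_right[OF adjoint_carrier[OF z]] by (intro sum.cong) auto
  also have "\<dots> = complex_of_real (\<Sum>a<q. \<mu> a * (cmod (z $$ (a, 0)))\<^sup>2)"
    by (simp only: of_real_sum of_real_mult complex_norm_square)
  finally show ?thesis .
qed

lemma norm_form:
  assumes z: "z \<in> carrier_mat q 1"
  shows "(z\<^sup>H * z) $$ (0, 0) = complex_of_real (\<Sum>a<q. (cmod (z $$ (a, 0)))\<^sup>2)"
  using quadratic_form_diag[OF z, of "\<lambda>_. 1"] right_mult_one_mat[OF adjoint_carrier[OF z]] by simp

text \<open>The singular values of \<open>B\<close> drop by at most \<open>k\<close> places under a perturbation of rank \<open>k\<close>.
  A nonzero vector in the span of the first \<open>i + k + 1\<close> right singular vectors of \<open>B\<close> can be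
  chosen to satisfy the \<open>k\<close> equations \<open>G x = 0\<close> and the \<open>i\<close> equations that make it orthogonal
  to the leading \<open>i\<close> right singular vectors of \<open>X\<close>, which are columns of \<open>Q\<close>. The vector
  \<open>X x = B x\<close> then has length at least \<open>\<sigma>\<^bsub>i+k\<^esub> |x|\<close> and at most \<open>\<surd>\<mu>\<^bsub>i\<^esub> |x|\<close>. Indices start
  at 0.\<close>

lemma weyl_low_rank_perturbation:
  fixes X B :: "complex mat"
  assumes W: "W \<in> carrier_mat p r" "W\<^sup>H * W = 1\<^sub>m r"
    and V: "V \<in> carrier_mat q r" "V\<^sup>H * V = 1\<^sub>m r"
    and B: "B = W * mat_diag r (\<lambda>i. complex_of_real (\<sigma> i)) * V\<^sup>H"
    and \<sigma>: "\<And>i j. i \<le> j \<Longrightarrow> j < r \<Longrightarrow> \<sigma> j \<le> \<sigma> i" "\<And>i. i < r \<Longrightarrow> \<sigma> i \<ge> 0"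
    and F: "F \<in> carrier_mat p k" and G: "G \<in> carrier_mat k q"
    and X: "X = B - F * G"
    and Q: "Q \<in> carrier_mat q q" "Q * Q\<^sup>H = 1\<^sub>m q"
    and gram: "X\<^sup>H * X = Q * mat_diag q (\<lambda>i. complex_of_real (\<mu> i)) * Q\<^sup>H"
    and \<mu>: "\<And>i j. i \<le> j \<Longrightarrow> j < q \<Longrightarrow> \<mu> j \<le> \<mu> i"
    and i: "i + k < r" "r \<le> q"
  shows "(\<sigma> (i + k))\<^sup>2 \<le> \<mu> i"
proof -
  define S where "S = mat_diag r (\<lambda>i. complex_of_real (\<sigma> i))"
  define D where "D = mat_diag q (\<lambda>i. complex_of_real (\<mu> i))"
  have S: "S \<in> carrier_mat r r" and D: "D \<in> carrier_mat q q" by (auto simp: S_def D_def)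
  note dims = carrier_matD[OF W(1)] carrier_matD[OF V(1)] carrier_matD[OF S] carrier_matD[OF F]
    carrier_matD[OF G] carrier_matD[OF Q(1)] carrier_matD[OF D]
  (* The k + i equations in the coordinates of x with respect to the right singular
     vectors of B: first G x = 0, then the leading i entries of Q* x. *)
  define M where "M = Matrix.mat (k + i) (i + k + 1)
    (\<lambda>(a, b). if a < k then (G * V) $$ (a, b) else (Q\<^sup>H * V) $$ (a - k, b))"
  have M: "M \<in> carrier_mat (k + i) (i + k + 1)" by (simp add: M_def)
  obtain y0 where y0: "y0 \<in> carrier_mat (i + k + 1) 1" "y0 \<noteq> 0\<^sub>m (i + k + 1) 1"
    "M * y0 = 0\<^sub>m (k + i) 1"
    using wide_matrix_kernel[OF M] by auto
  define y where "y = Matrix.mat r 1 (\<lambda>(a, b). if a < i + k + 1 then y0 $$ (a, 0) else 0)"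
  have y: "y \<in> carrier_mat r 1" by (simp add: y_def)
  define x where "x = V * y"
  have x: "x \<in> carrier_mat q 1" using V y by (auto simp: x_def)
  note dims' = dims carrier_matD[OF x] carrier_matD[OF y]
  have pad: "(N * y) $$ (a, 0) = (\<Sum>b<i + k + 1. N $$ (a, b) * y0 $$ (b, 0))"
    if "N \<in> carrier_mat c r" "a < c" for N c a
  proof -
    have "(N * y) $$ (a, 0) = (\<Sum>b<r. N $$ (a, b) * y $$ (b, 0))"
      using that y by (subst mat_mult_index) auto
    also have "\<dots> = (\<Sum>b<i + k + 1. N $$ (a, b) * y0 $$ (b, 0))"
      using i by (intro sum.mono_neutral_cong_right) (auto simp: y_def)
    finally show ?thesis .
  qed
  have My0: "(\<Sum>b<i + k + 1. M $$ (a, b) * y0 $$ (b, 0)) = 0" if "a < k + i" for a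
  proof -
    have "(M * y0) $$ (a, 0) = (\<Sum>b<i + k + 1. M $$ (a, b) * y0 $$ (b, 0))"
      using that M y0(1) by (subst mat_mult_index) auto
    then show ?thesis using y0(3) that by simp
  qed
  have GV: "G * V \<in> carrier_mat k r" "Q\<^sup>H * V \<in> carrier_mat q r" using G V Q by auto
  have Gx: "G * x = 0\<^sub>m k 1"
  proof (rule eq_matI)
    fix a b assume "a < dim_row (0\<^sub>m k 1 :: complex mat)" "b < dim_col (0\<^sub>m k 1 :: complex mat)"
    then have ab: "a < k" "b = 0" by auto
    have "G * x = G * V * y" by (simp add: x_def mult_mat_assoc dims')
    then show "(G * x) $$ (a, b) = 0\<^sub>m k 1 $$ (a, b)"
      using pad[OF GV(1) ab(1)] My0[of a] ab by (simp add: M_def)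
  qed (use G x in auto)
  define z where "z = Q\<^sup>H * x"
  have z: "z \<in> carrier_mat q 1" using Q x by (auto simp: z_def)
  have z0: "z $$ (a, 0) = 0" if "a < i" for a
  proof -
    have "z = Q\<^sup>H * V * y" by (simp add: z_def x_def mult_mat_assoc dims')
    then show ?thesis
      using pad[OF GV(2), of a] My0[of "k + a"] that i by (simp add: M_def)
  qed
  have Bx: "X * x = W * (S * y)"
  proof -
    have "X * x = B * x - F * G * x"
      unfolding X using W V S F G x by (intro minus_mult_distrib_mat[of _ p q]) (auto simp: B S_def[symmetric])
    also have "F * G * x = 0\<^sub>m p 1"
      using F by (simp add: mult_mat_assoc dims' Gx)
    also have "B * x = W * (S * ((V\<^sup>H * V) * y))"
      by (simp add: B S_def[symmetric] x_def mult_mat_assoc dims' del: V(2))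
    also have "\<dots> = W * (S * y)" unfolding V(2) using y by simp
    also have "\<dots> - 0\<^sub>m p 1 = \<dots>" by (rule eq_matI) (auto simp: dims' simp del: index_mult_mat(1))
    finally show ?thesis .
  qed
  have XD: "X \<in> carrier_mat p q" unfolding X using F G by auto
  have "(X * x)\<^sup>H * (X * x) = y\<^sup>H * (S\<^sup>H * ((W\<^sup>H * W) * (S * y)))"
    unfolding Bx by (simp add: adjoint_mult mult_mat_assoc dims' del: W(2))
  also have "\<dots> = y\<^sup>H * (S * S) * y"
    unfolding W(2) using S y by (simp add: mult_mat_assoc dims') (simp add: S_def adjoint_diag)
  also have "S * S = mat_diag r (\<lambda>i. complex_of_real ((\<sigma> i)\<^sup>2))"
    by (simp add: S_def power2_eq_square)
  finally have low: "((X * x)\<^sup>H * (X * x)) $$ (0, 0) = complex_of_real (\<Sum>a<r. (\<sigma> a)\<^sup>2 * (cmod (y $$ (a, 0)))\<^sup>2)"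
    by (simp only: quadratic_form_diag[OF y])
  have "(X * x)\<^sup>H * (X * x) = x\<^sup>H * (X\<^sup>H * X) * x"
    using XD by (simp add: adjoint_mult mult_mat_assoc dims')
  also have "\<dots> = z\<^sup>H * D * z"
    unfolding gram D_def[symmetric] by (simp add: z_def adjoint_mult mult_mat_assoc dims')
  finally have up: "((X * x)\<^sup>H * (X * x)) $$ (0, 0) = complex_of_real (\<Sum>a<q. \<mu> a * (cmod (z $$ (a, 0)))\<^sup>2)"
    using quadratic_form_diag[OF z] by (simp add: D_def)
  have "z\<^sup>H * z = y\<^sup>H * (V\<^sup>H * ((Q * Q\<^sup>H) * (V * y)))"
    by (simp add: z_def x_def adjoint_mult mult_mat_assoc dims' del: Q(2))
  also have "\<dots> = y\<^sup>H * ((V\<^sup>H * V) * y)"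
    unfolding Q(2) using V(1) y by (simp add: mult_mat_assoc dims' del: V(2))
  also have "\<dots> = y\<^sup>H * y" unfolding V(2) using y by simp
  finally have zy: "(\<Sum>a<q. (cmod (z $$ (a, 0)))\<^sup>2) = (\<Sum>a<r. (cmod (y $$ (a, 0)))\<^sup>2)"
    using norm_form[OF z] norm_form[OF y] by (simp only: of_real_eq_iff)
  define l where "l = (\<Sum>a<r. (cmod (y $$ (a, 0)))\<^sup>2)"
  have "l \<noteq> 0"
  proof
    assume "l = 0"
    then have yz: "y $$ (a, 0) = 0" if "a < r" for a
      unfolding l_def using that by (subst (asm) sum_nonneg_eq_0_iff) auto
    have "y0 $$ (a, 0) = 0" if "a < i + k + 1" for a
      using that i yz[of a] by (simp add: y_def)
    then have "y0 = 0\<^sub>m (i + k + 1) 1" using y0(1) by (intro eq_matI) auto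
    then show False using y0(2) by simp
  qed
  then have l: "l > 0" using sum_nonneg[of "{..<r}" "\<lambda>a. (cmod (y $$ (a, 0)))\<^sup>2"] by (simp add: l_def less_le)
  have "(\<sigma> (i + k))\<^sup>2 * l \<le> (\<Sum>a<r. (\<sigma> a)\<^sup>2 * (cmod (y $$ (a, 0)))\<^sup>2)"
    unfolding l_def sum_distrib_left
  proof (rule sum_mono)
    fix a assume "a \<in> {..<r}"
    show "(\<sigma> (i + k))\<^sup>2 * (cmod (y $$ (a, 0)))\<^sup>2 \<le> (\<sigma> a)\<^sup>2 * (cmod (y $$ (a, 0)))\<^sup>2"
    proof (cases "a < i + k + 1")
      case True
      then have "\<sigma> (i + k) \<le> \<sigma> a" "0 \<le> \<sigma> (i + k)" using \<sigma> i by auto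
      then show ?thesis by (intro mult_right_mono power_mono) auto
    next
      case False
      then show ?thesis using \<open>a \<in> {..<r}\<close> by (simp add: y_def)
    qed
  qed
  also have "\<dots> = (\<Sum>a<q. \<mu> a * (cmod (z $$ (a, 0)))\<^sup>2)"
    using low up by (simp only: of_real_eq_iff)
  also have "\<dots> \<le> (\<Sum>a<q. \<mu> i * (cmod (z $$ (a, 0)))\<^sup>2)"
  proof (rule sum_mono)
    fix a assume "a \<in> {..<q}"
    then show "\<mu> a * (cmod (z $$ (a, 0)))\<^sup>2 \<le> \<mu> i * (cmod (z $$ (a, 0)))\<^sup>2"
      using z0[of a] \<mu>[of i a] by (cases "a < i") (auto intro: mult_right_mono)
  qed
  also have "\<dots> = \<mu> i * l" unfolding l_def zy[symmetric] by (simp add: sum_distrib_left)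
  finally show ?thesis using l by simp
qed

section \<open>Unitarily invariant norms\<close>

locale nuui_norm = nuui_submult_norm K nrm + real_or_complex K for K nrm
begin

text \<open>The generating function vanishes on the empty list, as the \<open>1 \<times> 1\<close> zero matrix shows. It
  therefore also describes matrices without rows or columns, whose norm is 0 by convention, and
  matrices of any two sizes can be compared.\<close>

lemma nrm_eq_if_sing_vals_eq:
  assumes B: "B \<in> kmat K p q" and D: "D \<in> kmat K p' q'" and eq: "sing_vals B = sing_vals D"
  shows "nrm B = nrm D"
proof -
  obtain \<phi> :: "real list \<Rightarrow> real" where
    \<phi>: "\<And>p q B. p \<ge> 1 \<Longrightarrow> q \<ge> 1 \<Longrightarrow> B \<in> kmat K p q \<Longrightarrow> nrm B = \<phi> (sing_vals B)"
    using uniformly_generated by blast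
  have "mrank (0\<^sub>m 1 1) = 0" unfolding mrank_def by (simp add: vec_space.rank_0I)
  then have "sing_vals (0\<^sub>m 1 1) = []"
    using mrank_eq_length_sing_vals[of "0\<^sub>m 1 1" 1 1] by simp
  then have nil: "\<phi> [] = 0"
    using \<phi>[of 1 1 "0\<^sub>m 1 1"] definite[of 1 1 "0\<^sub>m 1 1"] kmat_zero by simp
  have all: "nrm M = \<phi> (sing_vals M)" if M: "M \<in> kmat K a b" for M a b
  proof (cases "a = 0 \<or> b = 0")
    case True
    then have "mrank M = 0"
      using mrank_le_dim_col[of M] mrank_le_dim_col[of "M\<^sup>H"] mrank_adjoint[of M] kmatD[OF M] by auto
    then have "sing_vals M = []" using mrank_eq_length_sing_vals[OF kmatD[OF M]] by simp
    then show ?thesis using nil empty[of M] True kmatD[OF M] by auto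
  next
    case False
    then show ?thesis using \<phi>[OF _ _ M] by simp
  qed
  show ?thesis using all[OF B] all[OF D] eq by simp
qed

lemma nrm_adjoint: "B \<in> kmat K p q \<Longrightarrow> nrm (B\<^sup>H) = nrm B"
  using nrm_eq_if_sing_vals_eq[OF kmat_adjoint] sing_vals_adjoint[OF kmatD] by blast

lemma nrm_isometries:
  assumes W: "W \<in> kmat K p r" "W\<^sup>H * W = 1\<^sub>m r" and V: "V \<in> kmat K q s" "V\<^sup>H * V = 1\<^sub>m s"
    and D: "D \<in> kmat K r s"
  shows "nrm (W * D * V\<^sup>H) = nrm D"
  by (rule nrm_eq_if_sing_vals_eq[OF kmat_mult[OF kmat_mult[OF W(1) D] kmat_adjoint[OF V(1)]] D])
    (rule sing_vals_isometries[OF kmatD[OF W(1)] W(2) kmatD[OF V(1)] V(2) kmatD[OF D]])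

lemma nrm_right_isometry:
  assumes B: "B \<in> kmat K p s" and V: "V \<in> kmat K q s" "V\<^sup>H * V = 1\<^sub>m s"
  shows "nrm (B * V\<^sup>H) = nrm B"
  using nrm_isometries[OF kmat_one _ V B] kmatD[OF B] by simp

lemma nrm_nonneg: "B \<in> kmat K p q \<Longrightarrow> nrm B \<ge> 0"
  using empty[of B] nonneg[of p q B] kmatD[of B p q] by (cases "p = 0 \<or> q = 0") auto

lemma nrm_triangle:
  "B \<in> kmat K p q \<Longrightarrow> D \<in> kmat K p q \<Longrightarrow> nrm (B + D) \<le> nrm B + nrm D"
  using empty[of "B + D"] triangle[of p q B D] nrm_nonneg[of B p q] nrm_nonneg[of D p q]
    kmatD[of B p q] kmatD[of D p q]
  by (cases "p = 0 \<or> q = 0") auto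

lemma nrm_smult: "B \<in> kmat K p q \<Longrightarrow> c \<in> K \<Longrightarrow> nrm (c \<cdot>\<^sub>m B) = cmod c * nrm B"
  using empty[of B] empty[of "c \<cdot>\<^sub>m B"] homogeneous[of p q B c] kmatD[of B p q]
  by (cases "p = 0 \<or> q = 0") auto

lemma nrm_triangle_minus:
  assumes "B \<in> kmat K p q" "D \<in> kmat K p q"
  shows "nrm (B - D) \<le> nrm B + nrm D"
proof -
  have m1: "-1 \<in> K" using scalar_closed(3)[of "-1"] by simp
  have "B - D = B + (-1) \<cdot>\<^sub>m D"
    using kmatD[OF assms(1)] kmatD[OF assms(2)] by (intro eq_matI) auto
  then show ?thesis
    using nrm_triangle[OF assms(1) kmat_smult[OF m1 assms(2)]] nrm_smult[OF assms(2) m1] by simp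
qed

lemma nrm_mult:
  assumes B: "B \<in> kmat K p q" and D: "D \<in> kmat K q r"
  shows "nrm (B * D) \<le> nrm B * nrm D"
proof (cases "p = 0 \<or> q = 0 \<or> r = 0")
  case True
  have "nrm (B * D) = 0"
  proof (cases "p = 0 \<or> r = 0")
    case True
    then show ?thesis using empty[of "B * D"] kmatD[OF B] kmatD[OF D] by auto
  next
    case False
    have "B * D = 0\<^sub>m p r"
      using kmatD[OF B] kmatD[OF D] True False by (intro eq_matI) (auto simp: scalar_prod_def)
    then show ?thesis using definite[of p r "0\<^sub>m p r"] kmat_zero False by simp
  qed
  then show ?thesis using nrm_nonneg[OF B] nrm_nonneg[OF D] by simp
next
  case False
  then show ?thesis using submultiplicative[OF _ _ _ B D] by simp
qed

lemma nrm_left_unitary: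
  assumes Q: "Q \<in> kmat K p p" "Q\<^sup>H * Q = 1\<^sub>m p" and B: "B \<in> kmat K p q"
  shows "nrm (Q * B) = nrm B"
  using nrm_isometries[OF Q kmat_one _ B] kmatD[OF B] kmatD[OF Q(1)] by simp

text \<open>A projection is the average of the identity and of the unitary reflection \<open>2 P - 1\<close>.
  This gives the bound although the norm of \<open>P\<close> itself may exceed 1.\<close>

lemma nrm_projection_mult_le:
  assumes P: "P \<in> kmat K p p" "P\<^sup>H = P" "P * P = P" and B: "B \<in> kmat K p q"
  shows "nrm (P * B) \<le> nrm B"
proof -
  note Pc = kmatD[OF P(1)] and Bc = kmatD[OF B]
  have two: "2 \<in> K" "1 / 2 \<in> K" using scalar_closed(3)[of 2] scalar_closed(3)[of "1 / 2"] by auto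
  define T where "T = 2 \<cdot>\<^sub>m P - 1\<^sub>m p"
  have T: "T \<in> kmat K p p" unfolding T_def by (intro kmat_minus kmat_smult two P kmat_one)
  have TH: "T\<^sup>H = T"
  proof (rule eq_matI)
    fix i j assume ij: "i < dim_row T" "j < dim_col T"
    then have "cnj (P $$ (j, i)) = P $$ (i, j)" using P(2) Pc adjoint_index[of i P j] by (auto simp: T_def)
    then show "T\<^sup>H $$ (i, j) = T $$ (i, j)" using ij Pc by (auto simp: T_def)
  qed (use kmatD[OF T] in auto)
  have "T * T = 2 \<cdot>\<^sub>m P * T - 1\<^sub>m p * T"
    unfolding T_def using Pc by (intro minus_mult_distrib_mat[of _ p p]) auto
  also have "2 \<cdot>\<^sub>m P * T = 2 \<cdot>\<^sub>m (P * T)" by (rule mult_smult_assoc_mat[OF Pc kmatD[OF T]])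
  also have "P * T = P * (2 \<cdot>\<^sub>m P) - P * 1\<^sub>m p"
    unfolding T_def using Pc by (intro mult_minus_distrib_mat[of _ p p]) auto
  also have "\<dots> = 2 \<cdot>\<^sub>m P - P" unfolding mult_smult_distrib[OF Pc Pc] P(3) using Pc by simp
  finally have "T * T = 2 \<cdot>\<^sub>m (2 \<cdot>\<^sub>m P - P) - T" using kmatD[OF T] by simp
  also have "\<dots> = 1\<^sub>m p" using Pc by (intro eq_matI) (auto simp: T_def)
  finally have TT: "T\<^sup>H * T = 1\<^sub>m p" unfolding TH .
  have "T * B = 2 \<cdot>\<^sub>m P * B - 1\<^sub>m p * B"
    unfolding T_def using Pc Bc by (intro minus_mult_distrib_mat[of _ p p]) auto
  also have "\<dots> = 2 \<cdot>\<^sub>m (P * B) - B" unfolding mult_smult_assoc_mat[OF Pc Bc] using Bc by simp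
  finally have TB: "T * B = 2 \<cdot>\<^sub>m (P * B) - B" .
  have "P * B = (1 / 2) \<cdot>\<^sub>m (B + T * B)"
    unfolding TB using Pc Bc by (intro eq_matI) (auto simp del: index_mult_mat(1))
  then have "nrm (P * B) = 1 / 2 * nrm (B + T * B)"
    using nrm_smult[OF kmat_add[OF B kmat_mult[OF T B]] two(2)] by simp
  also have "nrm (B + T * B) \<le> nrm B + nrm (T * B)" by (rule nrm_triangle[OF B kmat_mult[OF T B]])
  also have "nrm (T * B) = nrm B" by (rule nrm_left_unitary[OF T TT B])
  finally show ?thesis by simp
qed

text \<open>Multiplying by \<open>Z\<^sup>*\<close> on the right does not change the norm of \<open>B Z\<close>, and \<open>Z Z\<^sup>*\<close> is an
  orthogonal projection.\<close>

lemma nrm_mult_isometry_le: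
  assumes B: "B \<in> kmat K p q" and Z: "Z \<in> kmat K q s" "Z\<^sup>H * Z = 1\<^sub>m s"
  shows "nrm (B * Z) \<le> nrm B"
proof -
  note Zc = kmatD[OF Z(1)] and Bc = kmatD[OF B]
  note dims = carrier_matD[OF Zc] carrier_matD[OF Bc]
  have P: "(Z * Z\<^sup>H)\<^sup>H = Z * Z\<^sup>H" by (simp add: adjoint_mult)
  have "Z * Z\<^sup>H * (Z * Z\<^sup>H) = Z * ((Z\<^sup>H * Z) * Z\<^sup>H)" by (simp add: mult_mat_assoc del: Z(2))
  then have PP: "Z * Z\<^sup>H * (Z * Z\<^sup>H) = Z * Z\<^sup>H" unfolding Z(2) using Zc by simp
  have "nrm (B * Z) = nrm (B * Z * Z\<^sup>H)" by (rule nrm_right_isometry[OF kmat_mult[OF B Z(1)] Z, symmetric])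
  also have "B * Z * Z\<^sup>H = (Z * Z\<^sup>H * B\<^sup>H)\<^sup>H" by (simp add: adjoint_mult mult_mat_assoc dims)
  also have "nrm \<dots> = nrm (Z * Z\<^sup>H * B\<^sup>H)"
    by (rule nrm_adjoint[OF kmat_mult[OF kmat_mult[OF Z(1) kmat_adjoint[OF Z(1)]] kmat_adjoint[OF B]]])
  also have "\<dots> \<le> nrm (B\<^sup>H)"
    by (rule nrm_projection_mult_le[OF kmat_mult[OF Z(1) kmat_adjoint[OF Z(1)]] P PP kmat_adjoint[OF B]])
  finally show ?thesis using nrm_adjoint[OF B] by simp
qed

lemma nrm_submatrix_cols_le:
  assumes B: "B \<in> kmat K p q"
  shows "nrm (submatrix B UNIV J) \<le> nrm B"
proof -
  let ?Z = "submatrix (1\<^sub>m q) UNIV J :: complex mat"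
  have Z: "?Z \<in> kmat K q (card {j. j < q \<and> j \<in> J})"
    using kmat_submatrix[OF kmat_one[of q], of UNIV J] by simp
  show ?thesis
    unfolding submatrix_cols_eq_mult[OF kmatD[OF B]]
    by (rule nrm_mult_isometry_le[OF B Z column_selector_isometry])
qed

lemma nrm_submatrix_rows_le:
  assumes B: "B \<in> kmat K p q"
  shows "nrm (submatrix B I UNIV) \<le> nrm B"
  using nrm_submatrix_cols_le[OF kmat_adjoint[OF B], of I] nrm_adjoint[OF B]
    nrm_adjoint[OF kmat_submatrix[OF B], of I UNIV] by (simp add: adjoint_submatrix)

text \<open>A diagonal entry shrinks from \<open>s\<close> to \<open>c s\<close> with \<open>0 \<le> c \<le> 1\<close> by averaging with the matrix in
  which its sign is flipped.\<close>

lemma nrm_diag_shrink: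
  assumes t: "0 \<le> t" "t \<le> s"
  shows "nrm (mat_diag n (\<lambda>j. complex_of_real ((f(i := t)) j)))
       \<le> nrm (mat_diag n (\<lambda>j. complex_of_real ((f(i := s)) j)))"
proof (cases "s = 0")
  case False
  let ?d = "\<lambda>g. mat_diag n (\<lambda>j. complex_of_real (g j))"
  define c where "c = t / s"
  have c: "0 \<le> c" "c \<le> 1" "t = c * s" using t False by (auto simp: c_def field_simps)
  define R where "R = ?d ((\<lambda>_. 1)(i := -1))"
  have R: "R \<in> kmat K n n" by (simp add: R_def kmat_diag)
  have "R\<^sup>H * R = 1\<^sub>m n"
    unfolding R_def adjoint_diag mat_diag_diag by (rule eq_matI) (auto simp: mat_diag_def)
  moreover have flip: "?d (f(i := - s)) = R * ?d (f(i := s))"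
    unfolding R_def mat_diag_diag by (rule eq_matI) (auto simp: mat_diag_def)
  ultimately have eq: "nrm (?d (f(i := - s))) = nrm (?d (f(i := s)))"
    unfolding flip by (intro nrm_left_unitary[OF R]) (auto intro: kmat_diag)
  let ?a = "complex_of_real ((1 + c) / 2)" and ?b = "complex_of_real ((1 - c) / 2)"
  have "?d (f(i := t)) = ?a \<cdot>\<^sub>m ?d (f(i := s)) + ?b \<cdot>\<^sub>m ?d (f(i := - s))"
    unfolding c(3) by (rule eq_matI) (auto simp: mat_diag_def field_simps)
  then have "nrm (?d (f(i := t))) = nrm (?a \<cdot>\<^sub>m ?d (f(i := s)) + ?b \<cdot>\<^sub>m ?d (f(i := - s)))"
    by (rule arg_cong)
  also have "\<dots> \<le> nrm (?a \<cdot>\<^sub>m ?d (f(i := s))) + nrm (?b \<cdot>\<^sub>m ?d (f(i := - s)))"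
    by (rule nrm_triangle[OF kmat_smult[OF scalar_closed(3) kmat_diag] kmat_smult[OF scalar_closed(3) kmat_diag]])
  also have "\<dots> = cmod ?a * nrm (?d (f(i := s))) + cmod ?b * nrm (?d (f(i := - s)))"
    by (simp only: nrm_smult[OF kmat_diag scalar_closed(3)])
  also have "\<dots> = ((1 + c) / 2 + (1 - c) / 2) * nrm (?d (f(i := s)))"
    unfolding eq norm_of_real using c by (simp add: algebra_simps abs_if)
  finally show ?thesis by (simp add: field_simps)
qed (use t in auto)

lemma nrm_diag_mono:
  assumes ab: "\<And>i. i < n \<Longrightarrow> 0 \<le> a i" "\<And>i. i < n \<Longrightarrow> a i \<le> b i"
  shows "nrm (mat_diag n (\<lambda>i. complex_of_real (a i))) \<le> nrm (mat_diag n (\<lambda>i. complex_of_real (b i)))"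
proof -
  let ?d = "\<lambda>g. mat_diag n (\<lambda>j. complex_of_real (g j))"
  (* The entries of b are lowered to those of a one at a time. *)
  define f where "f m = (\<lambda>j. if j < m then a j else b j)" for m
  have "nrm (?d (f m)) \<le> nrm (?d b)" if "m \<le> n" for m
    using that
  proof (induction m)
    case 0 then show ?case by (simp add: f_def)
  next
    case (Suc m)
    have "f (Suc m) = (f m)(m := a m)" "f m = (f m)(m := b m)" by (auto simp: f_def)
    then have "nrm (?d (f (Suc m))) \<le> nrm (?d (f m))"
      using nrm_diag_shrink[of "a m" "b m" n "f m" m] ab[of m] Suc.prems by simp
    then show ?case using Suc by simp
  qed
  from this[of n] have "nrm (?d (f n)) \<le> nrm (?d b)" by simp
  moreover have "?d (f n) = ?d a" by (rule eq_matI) (auto simp: mat_diag_def f_def)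
  ultimately show ?thesis by simp
qed

end

section \<open>Truncated singular value decompositions\<close>

lemma compact_svdD:
  assumes "compact_svd K A W S V"
  shows "W \<in> kmat K (dim_row A) (mrank A)" "V \<in> kmat K (dim_col A) (mrank A)"
    "W\<^sup>H * W = 1\<^sub>m (mrank A)" "V\<^sup>H * V = 1\<^sub>m (mrank A)"
    "S = mat_diag (mrank A) (\<lambda>i. complex_of_real (sing_vals A ! i))"
    "A = W * S * V\<^sup>H"
  using assms unfolding compact_svd_def Let_def by blast+

lemma compact_svd_adjoint:
  assumes "compact_svd K A W S V" and roc: "real_or_complex K"
  shows "compact_svd K (A\<^sup>H) V S W"
proof -
  interpret real_or_complex K by (rule roc)
  define r where "r = mrank A"
  have W: "W \<in> kmat K (dim_row A) r" and V: "V \<in> kmat K (dim_col A) r"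
    and iso: "W\<^sup>H * W = 1\<^sub>m r" "V\<^sup>H * V = 1\<^sub>m r"
    and S: "S = mat_diag r (\<lambda>i. complex_of_real (sing_vals A ! i))"
    and A: "A = W * S * V\<^sup>H"
    using compact_svdD[OF assms(1)] unfolding r_def by blast+
  have "S\<^sup>H = S" by (simp add: S adjoint_diag)
  moreover have "dim_row S = r" "dim_col S = r" by (auto simp: S mat_diag_def)
  ultimately have AH: "A\<^sup>H = V * S * W\<^sup>H"
    using carrier_matD[OF kmatD[OF W]] carrier_matD[OF kmatD[OF V]]
    by (subst A) (simp add: adjoint_mult mult_mat_assoc)
  have "sing_vals (A\<^sup>H) = sing_vals A"
    by (rule sing_vals_adjoint[of A "dim_row A" "dim_col A"]) simp
  then show ?thesis
    unfolding compact_svd_def Let_def mrank_adjoint r_def[symmetric] adjoint_dim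
    using W V iso S AH by simp
qed

lemma truncated_svd_adjoint:
  assumes T: "truncated_svd K k B Bk" and roc: "real_or_complex K"
  shows "truncated_svd K k (B\<^sup>H) (Bk\<^sup>H)"
proof -
  interpret real_or_complex K by (rule roc)
  obtain W S V where svd: "compact_svd K B W S V"
    and Bk: "Bk = submatrix W UNIV {..<k} * submatrix S {..<k} {..<k} * (submatrix V UNIV {..<k})\<^sup>H"
    using T by (auto simp: truncated_svd_def)
  have d: "dim_col W = mrank B" "dim_col V = mrank B" "S \<in> carrier_mat (mrank B) (mrank B)" "S\<^sup>H = S"
    using kmatD[OF compact_svdD(1)[OF svd]] kmatD[OF compact_svdD(2)[OF svd]] compact_svdD(5)[OF svd]
    by (simp_all add: adjoint_diag)
  have "Bk\<^sup>H = submatrix V UNIV {..<k} * (submatrix S {..<k} {..<k})\<^sup>H * (submatrix W UNIV {..<k})\<^sup>H"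
    unfolding Bk using d by (simp add: adjoint_mult mult_mat_assoc dim_submatrix)
  also have "(submatrix S {..<k} {..<k})\<^sup>H = submatrix S {..<k} {..<k}"
    by (simp add: adjoint_submatrix d)
  finally show ?thesis
    using compact_svd_adjoint[OF svd roc] by (auto simp: truncated_svd_def)
qed

lemma pick_lessThan: "i < k \<Longrightarrow> pick {..<k} i = i"
proof -
  assume i: "i < k"
  then have "{a \<in> {..<k}. a < i} = {..<i}" by auto
  then show ?thesis using pick_card_in_set[of i "{..<k}"] i by simp
qed

text \<open>The discarded part \<open>B - B\<^sub>k\<close> is the factorisation of \<open>B\<close> with the leading \<open>k\<close> singular
  values replaced by zero.\<close>

lemma truncated_svdE:
  assumes T: "truncated_svd K k B Bk" and B: "B \<in> kmat K p q" and roc: "real_or_complex K"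
  obtains W V r where "r = mrank B" "W \<in> kmat K p r" "V \<in> kmat K q r"
    "W\<^sup>H * W = 1\<^sub>m r" "V\<^sup>H * V = 1\<^sub>m r"
    "B = W * mat_diag r (\<lambda>i. complex_of_real (sing_vals B ! i)) * V\<^sup>H"
    "B - Bk = W * mat_diag r (\<lambda>i. complex_of_real (if i < k then 0 else sing_vals B ! i)) * V\<^sup>H"
    "Bk \<in> kmat K p q"
proof -
  interpret real_or_complex K by (rule roc)
  obtain W S V where svd: "compact_svd K B W S V"
    and Bk: "Bk = submatrix W UNIV {..<k} * submatrix S {..<k} {..<k} * (submatrix V UNIV {..<k})\<^sup>H"
    using T by (auto simp: truncated_svd_def)
  define r where "r = mrank B"
  have W: "W \<in> kmat K p r" and V: "V \<in> kmat K q r"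
    and iso: "W\<^sup>H * W = 1\<^sub>m r" "V\<^sup>H * V = 1\<^sub>m r"
    and S: "S = mat_diag r (\<lambda>i. complex_of_real (sing_vals B ! i))"
    and BW: "B = W * S * V\<^sup>H"
    using compact_svdD[OF svd] unfolding r_def carrier_matD[OF kmatD[OF B]] by blast+
  note dims = carrier_matD[OF kmatD[OF W]] carrier_matD[OF kmatD[OF V]]
  have entry: "(W * mat_diag r (\<lambda>i. complex_of_real (f i)) * V\<^sup>H) $$ (a, b)
      = (\<Sum>c<r. W $$ (a, c) * complex_of_real (f c) * cnj (V $$ (b, c)))" if "a < p" "b < q" for f a b
  proof -
    have "(W * mat_diag r (\<lambda>i. complex_of_real (f i)) * V\<^sup>H) $$ (a, b)
      = (\<Sum>c<r. (W * mat_diag r (\<lambda>i. complex_of_real (f i))) $$ (a, c) * V\<^sup>H $$ (c, b))"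
      using that dims by (subst mat_mult_index) (auto simp: mat_diag_def)
    then show ?thesis
      using that dims unfolding mat_diag_mult_right[OF kmatD[OF W]] by simp
  qed
  define t where "t = min r k"
  have card_t: "card {i. i < r \<and> i \<in> {..<k}} = t"
  proof -
    have "{i. i < r \<and> i \<in> {..<k}} = {..<t}" by (auto simp: t_def)
    then show ?thesis by simp
  qed
  let ?Wk = "submatrix W UNIV {..<k}" and ?Vk = "submatrix V UNIV {..<k}"
  have Sk: "submatrix S {..<k} {..<k} = mat_diag t (\<lambda>i. complex_of_real (sing_vals B ! i))"
    using card_t
    by (intro eq_matI) (auto simp: S submatrix_def mat_diag_def t_def pick_lessThan)
  have WVk: "?Wk \<in> kmat K p t" "?Vk \<in> kmat K q t"
    using kmat_submatrix[OF W, of UNIV "{..<k}"] kmat_submatrix[OF V, of UNIV "{..<k}"]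
    unfolding card_t by simp_all
  have Bkk: "Bk \<in> kmat K p q"
    unfolding Bk Sk by (intro kmat_mult[OF kmat_mult[OF WVk(1) kmat_diag] kmat_adjoint[OF WVk(2)]])
  have "B - Bk = W * mat_diag r (\<lambda>i. complex_of_real (if i < k then 0 else sing_vals B ! i)) * V\<^sup>H"
  proof (rule eq_matI)
    fix a b assume "a < dim_row (W * mat_diag r (\<lambda>i. complex_of_real (if i < k then 0 else sing_vals B ! i)) * V\<^sup>H)"
      "b < dim_col (W * mat_diag r (\<lambda>i. complex_of_real (if i < k then 0 else sing_vals B ! i)) * V\<^sup>H)"
    then have ab: "a < p" "b < q" by (auto simp: dims)
    let ?g = "\<lambda>c. W $$ (a, c) * complex_of_real (sing_vals B ! c) * cnj (V $$ (b, c))"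
    have "Bk $$ (a, b) = (\<Sum>c<t. (?Wk * mat_diag t (\<lambda>i. complex_of_real (sing_vals B ! i))) $$ (a, c) * ?Vk\<^sup>H $$ (c, b))"
      unfolding Bk Sk using ab carrier_matD[OF kmatD[OF WVk(1)]] carrier_matD[OF kmatD[OF WVk(2)]]
      by (subst mat_mult_index) (auto simp: mat_diag_def)
    also have "\<dots> = (\<Sum>c<t. ?g c)"
    proof (rule sum.cong[OF refl])
      fix c assume "c \<in> {..<t}"
      then have c: "c < t" "c < k" "c < r" by (auto simp: t_def)
      have "?Wk $$ (a, c) = W $$ (a, c)" "?Vk $$ (b, c) = V $$ (b, c)"
        using c ab card_t dims by (auto simp: submatrix_index pick_lessThan pick_UNIV)
      then show "(?Wk * mat_diag t (\<lambda>i. complex_of_real (sing_vals B ! i))) $$ (a, c) * ?Vk\<^sup>H $$ (c, b) = ?g c"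
        using c ab carrier_matD[OF kmatD[OF WVk(1)]] carrier_matD[OF kmatD[OF WVk(2)]]
        unfolding mat_diag_mult_right[OF kmatD[OF WVk(1)]] by simp
    qed
    also have "\<dots> = (\<Sum>c<r. if c < k then ?g c else 0)"
      by (rule sum.mono_neutral_cong_left) (auto simp: t_def)
    finally have 1: "Bk $$ (a, b) = (\<Sum>c<r. if c < k then ?g c else 0)" .
    have 2: "B $$ (a, b) = (\<Sum>c<r. ?g c)"
      by (subst BW, unfold S) (rule entry[OF ab])
    have "(B - Bk) $$ (a, b) = B $$ (a, b) - Bk $$ (a, b)"
      using ab kmatD[OF Bkk] by auto
    also have "\<dots> = (\<Sum>c<r. W $$ (a, c) * complex_of_real (if c < k then 0 else sing_vals B ! c) * cnj (V $$ (b, c)))"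
      unfolding 1 2 sum_subtractf[symmetric] by (intro sum.cong) auto
    finally show "(B - Bk) $$ (a, b)
      = (W * mat_diag r (\<lambda>i. complex_of_real (if i < k then 0 else sing_vals B ! i)) * V\<^sup>H) $$ (a, b)"
      unfolding entry[OF ab] .
  qed (use kmatD[OF Bkk] dims in auto)
  then show ?thesis using Bkk by (rule that[OF r_def W V iso BW[unfolded S]])
qed

text \<open>The singular values beyond the \<open>k\<close>-th occupy the last places of the diagonal when the
  leading ones are zeroed out in place, and the first places when they are shifted to the front
  for the comparison with another matrix.\<close>

lemma nonzero_desc_shift:
  assumes "r \<le> q"
  shows "nonzero_desc r (\<lambda>i. if i < k then 0 else \<sigma> i) = nonzero_desc q (\<lambda>i. if i + k < r then \<sigma> (i + k) else 0)"
proof -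
  let ?nz = "filter (\<lambda>x. x \<noteq> (0::real))"
  have "?nz (map (\<lambda>i. if i < k then 0 else \<sigma> i) [0..<r]) = ?nz (map \<sigma> [k..<r])"
  proof (cases "k \<le> r")
    case True
    then have "[0..<r] = [0..<k] @ [k..<r]" using upt_add_eq_append[of 0 k "r - k"] by simp
    then show ?thesis by (auto simp: filter_empty_conv intro!: arg_cong[where f = ?nz])
  next
    case False
    then show ?thesis by (auto simp: filter_empty_conv)
  qed
  also have "\<dots> = ?nz (map (\<lambda>i. if i + k < r then \<sigma> (i + k) else 0) [0..<q])"
  proof -
    have "[0..<q] = [0..<r - k] @ [r - k..<q]" using upt_add_eq_append[of 0 "r - k" "q - (r - k)"] assms by simp
    moreover have "map (\<lambda>i. if i + k < r then \<sigma> (i + k) else 0) [0..<r - k] = map \<sigma> [k..<r]"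
      by (rule nth_equalityI) (auto simp: add.commute)
    moreover have "?nz (map (\<lambda>i. if i + k < r then \<sigma> (i + k) else 0) [r - k..<q]) = []"
      by (auto simp: filter_empty_conv)
    ultimately show ?thesis by simp
  qed
  finally have "mset (?nz (map (\<lambda>i. if i < k then 0 else \<sigma> i) [0..<r]))
      = mset (?nz (map (\<lambda>i. if i + k < r then \<sigma> (i + k) else 0) [0..<q]))"
    by simp
  then show ?thesis unfolding nonzero_desc_def by (simp only: mset_filter mset_map)
qed

context nuui_norm
begin

text \<open>The theorem of Schmidt and Mirsky: the norms of both differences are norms of diagonal
  matrices of their singular values, and the Weyl inequality compares the entries.\<close>

lemma truncated_svd_best_approximation:
  assumes T: "truncated_svd K k B Bk" and B: "B \<in> kmat K p q"
    and F: "F \<in> carrier_mat p k" and G: "G \<in> carrier_mat k q" and FG: "F * G \<in> kmat K p q"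
  shows "nrm (B - Bk) \<le> nrm (B - F * G)"
proof -
  let ?d = "\<lambda>n f. mat_diag n (\<lambda>i. complex_of_real (f i))"
  define \<sigma> where "\<sigma> i = sing_vals B ! i" for i
  define X where "X = B - F * G"
  obtain W V r where r: "r = mrank B" and W: "W \<in> kmat K p r" "W\<^sup>H * W = 1\<^sub>m r"
    and V: "V \<in> kmat K q r" "V\<^sup>H * V = 1\<^sub>m r"
    and BW: "B = W * ?d r \<sigma> * V\<^sup>H"
    and diff: "B - Bk = W * ?d r (\<lambda>i. if i < k then 0 else \<sigma> i) * V\<^sup>H"
    unfolding \<sigma>_def by (rule truncated_svdE[OF T B real_or_complex_axioms]) blast
  have len: "length (sing_vals B) = r" using mrank_eq_length_sing_vals[OF kmatD[OF B]] r by simp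
  have desc: "\<sigma> j \<le> \<sigma> i" if "i \<le> j" "j < r" for i j
    using sing_vals_desc that len by (simp add: \<sigma>_def)
  have nn: "\<sigma> i \<ge> 0" if "i < r" for i
    using sing_vals_nonneg[OF kmatD[OF B], of "\<sigma> i"] nth_mem[of i "sing_vals B"] that len by (simp add: \<sigma>_def)
  have rq: "r \<le> q" using mrank_le_dim_col[of B] kmatD[OF B] r by simp
  have Xk: "X \<in> kmat K p q" unfolding X_def by (rule kmat_minus[OF B FG])
  obtain Q \<mu> where Q: "Q \<in> carrier_mat q q" "Q * Q\<^sup>H = 1\<^sub>m q"
    and gram: "X\<^sup>H * X = Q * ?d q \<mu> * Q\<^sup>H"
    and \<mu>0: "\<And>j. j < q \<Longrightarrow> \<mu> j \<ge> 0" and \<mu>: "\<And>i j. i \<le> j \<Longrightarrow> j < q \<Longrightarrow> \<mu> j \<le> \<mu> i"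
    and cp: "char_poly (X\<^sup>H * X) = (\<Prod>j\<leftarrow>[0..<q]. [:- complex_of_real (\<mu> j), 1:])"
    by (rule gram_diagonalization[OF kmatD[OF Xk]]) blast
  define g where "g i = (if i + k < r then \<sigma> (i + k) else 0)" for i
  have g: "g = (\<lambda>i. if i + k < r then \<sigma> (i + k) else 0)" by (rule ext) (rule g_def)
  have "nrm (B - Bk) = nrm (?d r (\<lambda>i. if i < k then 0 else \<sigma> i))"
    unfolding diff by (rule nrm_isometries[OF W V kmat_diag])
  also have "\<dots> = nrm (?d q g)"
  proof (rule nrm_eq_if_sing_vals_eq[OF kmat_diag kmat_diag])
    have "sing_vals (?d r (\<lambda>i. if i < k then 0 else \<sigma> i)) = nonzero_desc r (\<lambda>i. if i < k then 0 else \<sigma> i)"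
      by (rule sing_vals_diag) (use nn in auto)
    moreover have "sing_vals (?d q g) = nonzero_desc q g"
      by (rule sing_vals_diag) (use nn in \<open>auto simp: g_def\<close>)
    ultimately show "sing_vals (?d r (\<lambda>i. if i < k then 0 else \<sigma> i)) = sing_vals (?d q g)"
      unfolding g using nonzero_desc_shift[OF rq, of k \<sigma>] by (simp only:)
  qed
  also have "\<dots> \<le> nrm (?d q (\<lambda>i. sqrt (\<mu> i)))"
  proof (rule nrm_diag_mono)
    fix i assume i: "i < q"
    show "0 \<le> g i" using nn by (simp add: g_def)
    show "g i \<le> sqrt (\<mu> i)"
    proof (cases "i + k < r")
      case True
      have "(\<sigma> (i + k))\<^sup>2 \<le> \<mu> i"
        by (rule weyl_low_rank_perturbation[OF kmatD[OF W(1)] W(2) kmatD[OF V(1)] V(2) BW desc nn F G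
              X_def Q gram \<mu> True rq])
      then show ?thesis using True by (simp add: g_def real_le_rsqrt)
    qed (use \<mu>0[OF i] in \<open>simp add: g_def\<close>)
  qed
  also have "\<dots> = nrm X"
  proof (rule nrm_eq_if_sing_vals_eq[OF kmat_diag Xk])
    have "sing_vals (?d q (\<lambda>i. sqrt (\<mu> i))) = nonzero_desc q (\<lambda>i. sqrt (\<mu> i))"
      by (rule sing_vals_diag) (use \<mu>0 in auto)
    then show "sing_vals (?d q (\<lambda>i. sqrt (\<mu> i))) = sing_vals X"
      using sing_vals_from_char_poly[OF cp] \<mu>0 by simp
  qed
  finally show ?thesis by (simp add: X_def)
qed

section \<open>Projection errors and the perturbation bound\<close>

lemma range_projection:
  assumes B: "B \<in> kmat K p q"
  shows "B * pinv B \<in> kmat K p p" "(B * pinv B)\<^sup>H = B * pinv B"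
    "B * pinv B * (B * pinv B) = B * pinv B" "B * pinv B * B = B"
proof -
  note x = is_pinv_pinv[of B, unfolded is_pinv_def]
  note dims = carrier_matD[OF kmatD[OF B]] carrier_matD[OF kmatD[OF kmat_pinv[OF B]]]
  show "B * pinv B \<in> kmat K p p" by (rule kmat_mult[OF B kmat_pinv[OF B]])
  show "(B * pinv B)\<^sup>H = B * pinv B" "B * pinv B * B = B" using x by blast+
  have "B * pinv B * (B * pinv B) = (B * pinv B * B) * pinv B" by (simp add: mult_mat_assoc dims)
  then show "B * pinv B * (B * pinv B) = B * pinv B" using x by simp
qed

lemma complement_projection:
  assumes P: "P \<in> kmat K p p" "P\<^sup>H = P" "P * P = P"
  shows "1\<^sub>m p - P \<in> kmat K p p" "(1\<^sub>m p - P)\<^sup>H = 1\<^sub>m p - P" "(1\<^sub>m p - P) * (1\<^sub>m p - P) = 1\<^sub>m p - P"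
proof -
  note Pc = kmatD[OF P(1)]
  show "1\<^sub>m p - P \<in> kmat K p p" by (rule kmat_minus[OF kmat_one P(1)])
  show "(1\<^sub>m p - P)\<^sup>H = 1\<^sub>m p - P" using adjoint_minus[OF one_carrier_mat Pc] P(2) by simp
  have "(1\<^sub>m p - P) * (1\<^sub>m p - P) = 1\<^sub>m p * (1\<^sub>m p - P) - P * (1\<^sub>m p - P)"
    using Pc by (intro minus_mult_distrib_mat[of _ p p]) auto
  also have "P * (1\<^sub>m p - P) = P * 1\<^sub>m p - P * P"
    using Pc by (intro mult_minus_distrib_mat[of _ p p]) auto
  also have "1\<^sub>m p * (1\<^sub>m p - P) - (P * 1\<^sub>m p - P * P) = 1\<^sub>m p - P"
    unfolding P(3) using Pc by (intro eq_matI) auto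
  finally show "(1\<^sub>m p - P) * (1\<^sub>m p - P) = 1\<^sub>m p - P" .
qed

text \<open>As the selected columns \<open>C\<close> have full rank, \<open>V\<^sub>J\<close> has a left inverse and \<open>A = C (V\<^sub>J\<^sup>\<dagger>)\<^sup>* V\<^sup>*\<close>, so
  it suffices to bound \<open>(1 - P) C\<close>. It equals \<open>(1 - P) ((C + E\<^sub>J) - C\<^sub>k) - (1 - P) E\<^sub>J\<close>, where
  both terms are at most \<open>\<parallel>E\<^sub>J\<parallel>\<close>, the first because \<open>C\<close> is a competitor of rank \<open>k\<close>.\<close>

lemma residual_of_column_projection:
  assumes A: "A \<in> kmat K m n" and E: "E \<in> kmat K m n"
    and svd: "compact_svd K A W S V"
    and rank: "mrank (submatrix A UNIV J) = mrank A"
    and T: "truncated_svd K (mrank A) (submatrix (A + E) UNIV J) Ck"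
  shows "nrm ((1\<^sub>m m - Ck * pinv Ck) * A)
       \<le> 2 * nrm (submatrix E UNIV J) * nrm (pinv (submatrix V J UNIV))"
proof -
  define k where "k = mrank A"
  define C EJ Ct VJ where "C = submatrix A UNIV J" and "EJ = submatrix E UNIV J"
    and "Ct = submatrix (A + E) UNIV J" and "VJ = submatrix V J UNIV"
  define c where "c = card {j. j < n \<and> j \<in> J}"
  have W: "W \<in> kmat K m k" and V: "V \<in> kmat K n k" "V\<^sup>H * V = 1\<^sub>m k"
    and S: "S \<in> kmat K k k" and AW: "A = W * S * V\<^sup>H"
  proof -
    show "W \<in> kmat K m k" "V \<in> kmat K n k"
      using compact_svdD(1,2)[OF svd] carrier_matD[OF kmatD[OF A]] by (simp_all add: k_def)
    show "V\<^sup>H * V = 1\<^sub>m k" unfolding k_def by (rule compact_svdD(4)[OF svd])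
    show "S \<in> kmat K k k" unfolding k_def compact_svdD(5)[OF svd] by (rule kmat_diag)
    show "A = W * S * V\<^sup>H" by (rule compact_svdD(6)[OF svd])
  qed
  have cm: "C \<in> kmat K m c" "EJ \<in> kmat K m c" "Ct \<in> kmat K m c" "VJ \<in> kmat K c k"
    using kmat_submatrix[OF A, of UNIV J] kmat_submatrix[OF E, of UNIV J]
      kmat_submatrix[OF kmat_add[OF A E], of UNIV J] kmat_submatrix[OF V(1), of J UNIV]
    by (simp_all add: C_def EJ_def Ct_def VJ_def c_def)
  have Ck: "Ck \<in> kmat K m c"
    by (rule truncated_svdE[OF T[folded Ct_def] cm(3) real_or_complex_axioms])
  have WS: "W * S \<in> kmat K m k" by (rule kmat_mult[OF W S])
  define X where "X = pinv VJ"
  have X: "X \<in> kmat K k c" unfolding X_def by (rule kmat_pinv[OF cm(4)])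
  note dims = carrier_matD[OF kmatD[OF cm(1)]] carrier_matD[OF kmatD[OF cm(2)]]
    carrier_matD[OF kmatD[OF cm(3)]] carrier_matD[OF kmatD[OF cm(4)]] carrier_matD[OF kmatD[OF X]]
    carrier_matD[OF kmatD[OF W]] carrier_matD[OF kmatD[OF S]] carrier_matD[OF kmatD[OF V(1)]]
    carrier_matD[OF kmatD[OF WS]] carrier_matD[OF kmatD[OF Ck]]
  have C: "C = W * S * VJ\<^sup>H"
    unfolding C_def VJ_def adjoint_submatrix AW
    by (rule submatrix_cols_mult[OF kmatD[OF WS] kmatD[OF kmat_adjoint[OF V(1)]]])
  have "C\<^sup>H = VJ * (W * S)\<^sup>H" unfolding C by (simp add: adjoint_mult dims)
  then have "mrank (C\<^sup>H) \<le> mrank VJ"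
    using mrank_mult_le_left[OF kmatD[OF cm(4)] kmatD[OF kmat_adjoint[OF WS]]] by simp
  then have "mrank VJ = k"
    using mrank_le_dim_col[of VJ] rank by (simp add: mrank_adjoint C_def[symmetric] k_def[symmetric] dims)
  then obtain Y where Y: "Y \<in> carrier_mat k c" "Y * VJ = 1\<^sub>m k"
    using full_column_rank_left_inverse[OF kmatD[OF cm(4)]] by blast
  have XV: "X * VJ = 1\<^sub>m k"
  proof -
    have "X * VJ = (Y * VJ) * (X * VJ)" unfolding Y(2) using kmatD[OF X] kmatD[OF cm(4)] by simp
    also have "\<dots> = Y * (VJ * X * VJ)" using Y(1) by (simp add: mult_mat_assoc dims)
    also have "VJ * X * VJ = VJ" using is_pinv_pinv[of VJ] by (simp add: X_def is_pinv_def)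
    finally show ?thesis using Y by simp
  qed
  define P where "P = Ck * pinv Ck"
  note P = range_projection[OF Ck, folded P_def]
  define N where "N = 1\<^sub>m m - P"
  note N = complement_projection[OF P(1-3), folded N_def]
  have NCk: "N * Ck = 0\<^sub>m m c"
  proof -
    have "N * Ck = 1\<^sub>m m * Ck - P * Ck"
      unfolding N_def using kmatD[OF P(1)] kmatD[OF Ck] by (intro minus_mult_distrib_mat[of _ m m]) auto
    then show ?thesis using P(4) kmatD[OF Ck] by simp
  qed
  have "C * X\<^sup>H * V\<^sup>H = W * S * (X * VJ)\<^sup>H * V\<^sup>H"
    unfolding C by (simp add: adjoint_mult mult_mat_assoc dims)
  also have "\<dots> = A" unfolding XV AW adjoint_one right_mult_one_mat[OF kmatD[OF WS]] ..
  finally have "N * A = N * (C * X\<^sup>H * V\<^sup>H)" by simp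
  also have "\<dots> = N * C * X\<^sup>H * V\<^sup>H"
    using kmatD[OF N(1)] by (simp add: mult_mat_assoc dims)
  finally have "nrm (N * A) = nrm (N * C * X\<^sup>H * V\<^sup>H)" by simp
  also have "\<dots> = nrm (N * C * X\<^sup>H)"
    by (rule nrm_right_isometry[OF kmat_mult[OF kmat_mult[OF N(1) cm(1)] kmat_adjoint[OF X]] V])
  also have "\<dots> \<le> nrm (N * C) * nrm (X\<^sup>H)"
    by (rule nrm_mult[OF kmat_mult[OF N(1) cm(1)] kmat_adjoint[OF X]])
  also have "nrm (X\<^sup>H) = nrm X" by (rule nrm_adjoint[OF X])
  also have "nrm (N * C) * nrm X \<le> (2 * nrm EJ) * nrm X"
  proof (rule mult_right_mono[OF _ nrm_nonneg[OF X]])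
    have CtC: "Ct - C = EJ"
      using kmatD[OF A] kmatD[OF E] unfolding Ct_def C_def EJ_def
      by (intro eq_matI) (auto simp: submatrix_def pick_le pick_UNIV)
    have "N * (Ct - Ck) - N * EJ = N * Ct - N * Ck - N * EJ"
      using kmatD[OF N(1)] kmatD[OF cm(3)] kmatD[OF Ck] by (subst mult_minus_distrib_mat[of _ m m]) auto
    also have "\<dots> = N * Ct - N * EJ"
      unfolding NCk using kmatD[OF N(1)] by (intro eq_matI) (auto simp: dims simp del: index_mult_mat(1))
    also have "\<dots> = N * (Ct - EJ)"
      using kmatD[OF N(1)] kmatD[OF cm(3)] kmatD[OF cm(2)] by (subst mult_minus_distrib_mat[of _ m m]) auto
    also have "Ct - EJ = C"
      unfolding CtC[symmetric] by (rule eq_matI) (auto simp: dims)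
    finally have "nrm (N * C) = nrm (N * (Ct - Ck) - N * EJ)" by simp
    also have "\<dots> \<le> nrm (N * (Ct - Ck)) + nrm (N * EJ)"
      by (rule nrm_triangle_minus[OF kmat_mult[OF N(1) kmat_minus[OF cm(3) Ck]] kmat_mult[OF N(1) cm(2)]])
    also have "nrm (N * (Ct - Ck)) \<le> nrm (Ct - Ck)"
      by (rule nrm_projection_mult_le[OF N kmat_minus[OF cm(3) Ck]])
    also have "nrm (Ct - Ck) \<le> nrm (Ct - W * S * VJ\<^sup>H)"
      by (rule truncated_svd_best_approximation[OF T[folded Ct_def k_def] cm(3) kmatD[OF WS]
            kmatD[OF kmat_adjoint[OF cm(4)]] kmat_mult[OF WS kmat_adjoint[OF cm(4)]]])
    also have "Ct - W * S * VJ\<^sup>H = EJ" using CtC C by simp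
    also have "nrm (N * EJ) \<le> nrm EJ" by (rule nrm_projection_mult_le[OF N cm(2)])
    finally show "nrm (N * C) \<le> 2 * nrm EJ" by simp
  qed
  finally show ?thesis by (simp add: N_def P_def EJ_def X_def VJ_def)
qed

end

theorem theorem4p9:
  fixes K :: "complex set"
    and nrm :: "complex mat \<Rightarrow> real"
    and m n k :: nat
    and I J :: "nat set"
    and A E At C R U Ct Rt EI EJ W S V WI VJ Ctk Rtk :: "complex mat"
  assumes K: "K = \<real> \<or> K = UNIV"
    and A: "A \<in> kmat K m n" and E: "E \<in> kmat K m n"
    and At: "At = A + E"
    and k: "k = mrank A"
    and I: "I \<subseteq> {..<m}" and J: "J \<subseteq> {..<n}"
    and C: "C = submatrix A UNIV J"
    and R: "R = submatrix A I UNIV"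
    and U: "U = submatrix A I J"
    and Ct: "Ct = submatrix At UNIV J"
    and Rt: "Rt = submatrix At I UNIV"
    and EI: "EI = submatrix E I UNIV"
    and EJ: "EJ = submatrix E UNIV J"
    and ranks: "mrank C = k" "mrank U = k" "mrank R = k"
    and svd: "compact_svd K A W S V"
    and WI: "WI = submatrix W I UNIV"
    and VJ: "VJ = submatrix V J UNIV"
    and Ctk: "truncated_svd K k Ct Ctk"
    and Rtk: "truncated_svd K k Rt Rtk"
    and nrm: "nuui_submult_norm K nrm"
  shows "nrm (A - Ctk * pinv Ctk * At * pinv Rtk * Rtk)
           \<le> 2 * (nrm EI * nrm (pinv WI) + nrm EJ * nrm (pinv VJ) + 3 / 2 * nrm E)
       \<and> nrm (A - Ctk * pinv Ctk * At * pinv Rtk * Rtk)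
           \<le> 2 * nrm E * (nrm (pinv WI) + nrm (pinv VJ) + 3 / 2)"
proof -
  have roc: "real_or_complex K" using K by unfold_locales
  interpret nuui_norm K nrm
    by (intro nuui_norm.intro nrm roc)
  have Atk: "At \<in> kmat K m n" unfolding At by (rule kmat_add[OF A E])
  define c r where "c = card {j. j < n \<and> j \<in> J}" and "r = card {i. i < m \<and> i \<in> I}"
  have Ctc: "Ct \<in> kmat K m c" and Rtc: "Rt \<in> kmat K r n"
    using kmat_submatrix[OF Atk, of UNIV J] kmat_submatrix[OF Atk, of I UNIV]
    by (simp_all add: Ct Rt c_def r_def)
  have Ck: "Ctk \<in> kmat K m c" by (rule truncated_svdE[OF Ctk Ctc roc])
  have Rk: "Rtk \<in> kmat K r n" by (rule truncated_svdE[OF Rtk Rtc roc])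
  define P where "P = Ctk * pinv Ctk"
  define Q where "Q = pinv Rtk * Rtk"
  have Qadj: "Q = Rtk\<^sup>H * pinv (Rtk\<^sup>H)"
  proof -
    have "Q = Q\<^sup>H" using is_pinv_pinv[of Rtk] by (simp add: Q_def is_pinv_def)
    then show ?thesis
      using kmatD[OF Rk] kmatD[OF kmat_pinv[OF Rk]] by (simp add: Q_def adjoint_mult pinv_adjoint)
  qed
  note P = range_projection[OF Ck, folded P_def]
  note Q = range_projection[OF kmat_adjoint[OF Rk], folded Qadj]
  have left: "nrm ((1\<^sub>m m - P) * A) \<le> 2 * nrm EJ * nrm (pinv VJ)"
    unfolding P_def EJ VJ
    by (rule residual_of_column_projection[OF A E svd])
      (use ranks Ctk in \<open>simp_all add: C k Ct At\<close>)
  have right: "nrm ((1\<^sub>m n - Q) * A\<^sup>H) \<le> 2 * nrm EI * nrm (pinv WI)"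
  proof -
    have sub: "submatrix (A\<^sup>H) UNIV I = R\<^sup>H" "submatrix (A\<^sup>H + E\<^sup>H) UNIV I = Rt\<^sup>H"
      "submatrix (E\<^sup>H) UNIV I = EI\<^sup>H"
      by (simp_all add: R Rt EI At adjoint_submatrix adjoint_add[OF kmatD[OF A] kmatD[OF E]])
    have "nrm ((1\<^sub>m n - Q) * A\<^sup>H) \<le> 2 * nrm (submatrix (E\<^sup>H) UNIV I) * nrm (pinv (submatrix W I UNIV))"
      unfolding Qadj
      by (rule residual_of_column_projection[OF kmat_adjoint[OF A] kmat_adjoint[OF E]
            compact_svd_adjoint[OF svd roc]])
        (use ranks truncated_svd_adjoint[OF Rtk roc] in \<open>simp_all add: sub mrank_adjoint k\<close>)
    moreover have "nrm (EI\<^sup>H) = nrm EI"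
      using nrm_adjoint[OF kmat_submatrix[OF E, of I UNIV]] by (simp add: EI)
    ultimately show ?thesis by (simp add: sub WI)
  qed
  define N where "N = 1\<^sub>m n - Q"
  note N = complement_projection[OF Q(1-3), folded N_def]
  note dims = carrier_matD[OF kmatD[OF A]] carrier_matD[OF kmatD[OF E]] carrier_matD[OF kmatD[OF P(1)]]
    carrier_matD[OF kmatD[OF Q(1)]] carrier_matD[OF kmatD[OF Ck]] carrier_matD[OF kmatD[OF Rk]]
    carrier_matD[OF kmatD[OF kmat_pinv[OF Ck]]] carrier_matD[OF kmatD[OF kmat_pinv[OF Rk]]]
    carrier_matD[OF kmatD[OF N(1)]] carrier_matD[OF kmatD[OF Atk]]
  have AN: "nrm (A * N) \<le> 2 * nrm EI * nrm (pinv WI)"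
  proof -
    have "A * N = (N * A\<^sup>H)\<^sup>H" using N(2) by (simp add: adjoint_mult dims)
    then have "nrm (A * N) = nrm (N * A\<^sup>H)"
      using nrm_adjoint[OF kmat_mult[OF N(1) kmat_adjoint[OF A]]] by simp
    then show ?thesis using right by (simp add: N_def)
  qed
  have EQ: "nrm (E * Q) \<le> nrm E"
  proof -
    have "E * Q = (Q * E\<^sup>H)\<^sup>H" using Q(2) by (simp add: adjoint_mult dims)
    then have "nrm (E * Q) = nrm (Q * E\<^sup>H)"
      using nrm_adjoint[OF kmat_mult[OF Q(1) kmat_adjoint[OF E]]] by simp
    also have "\<dots> \<le> nrm (E\<^sup>H)" by (rule nrm_projection_mult_le[OF Q(1-3) kmat_adjoint[OF E]])
    finally show ?thesis using nrm_adjoint[OF E] by simp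
  qed
  have c: "(1\<^sub>m m - P) * A \<in> kmat K m n" "P * (A * N) \<in> kmat K m n" "P * (E * Q) \<in> kmat K m n"
    "A * N \<in> kmat K m n" "E * Q \<in> kmat K m n"
    by (intro kmat_mult[OF kmat_minus[OF kmat_one P(1)] A] kmat_mult[OF P(1)] kmat_mult[OF A N(1)] kmat_mult[OF E Q(1)])+
  (* The three parts of the error: what P misses of A, what Q misses of A, and E compressed. *)
  have split: "A - Ctk * pinv Ctk * At * pinv Rtk * Rtk = (1\<^sub>m m - P) * A + P * (A * N) - P * (E * Q)"
  proof -
    have cs: "A \<in> carrier_mat m n" "P \<in> carrier_mat m m" "Q \<in> carrier_mat n n" "E \<in> carrier_mat m n"
      using kmatD A P(1) Q(1) E by auto
    have "Ctk * pinv Ctk * At * pinv Rtk * Rtk = P * (At * Q)"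
      by (simp add: P_def Q_def mult_mat_assoc dims)
    also have "At * Q = A * Q + E * Q"
      unfolding At using cs by (intro add_mult_distrib_mat[of _ m n]) auto
    also have "P * (A * Q + E * Q) = P * (A * Q) + P * (E * Q)"
      using cs by (intro mult_add_distrib_mat[of _ m m]) auto
    finally have 1: "Ctk * pinv Ctk * At * pinv Rtk * Rtk = P * (A * Q) + P * (E * Q)" .
    have 2: "(1\<^sub>m m - P) * A = A - P * A"
      using cs by (subst minus_mult_distrib_mat[of _ m m]) auto
    have "A * N = A - A * Q"
      unfolding N_def using cs by (subst mult_minus_distrib_mat[of _ m n]) auto
    then have 3: "P * (A * N) = P * A - P * (A * Q)"
      using cs by (simp add: mult_minus_distrib_mat[of _ m m])
    show ?thesis
      unfolding 1 2 3 by (rule eq_matI) (auto simp: dims simp del: index_mult_mat(1))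
  qed
  have "nrm (A - Ctk * pinv Ctk * At * pinv Rtk * Rtk)
      \<le> nrm ((1\<^sub>m m - P) * A + P * (A * N)) + nrm (P * (E * Q))"
    unfolding split by (rule nrm_triangle_minus[OF kmat_add[OF c(1,2)] c(3)])
  also have "nrm ((1\<^sub>m m - P) * A + P * (A * N)) \<le> nrm ((1\<^sub>m m - P) * A) + nrm (P * (A * N))"
    by (rule nrm_triangle[OF c(1,2)])
  also have "nrm (P * (A * N)) \<le> nrm (A * N)" by (rule nrm_projection_mult_le[OF P(1-3) c(4)])
  also have "nrm (P * (E * Q)) \<le> nrm (E * Q)" by (rule nrm_projection_mult_le[OF P(1-3) c(5)])
  finally have bound: "nrm (A - Ctk * pinv Ctk * At * pinv Rtk * Rtk)
      \<le> 2 * nrm EJ * nrm (pinv VJ) + 2 * nrm EI * nrm (pinv WI) + nrm E"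
    using left AN EQ by linarith
  have E0: "nrm E \<ge> 0" by (rule nrm_nonneg[OF E])
  have Wm: "W \<in> kmat K m (mrank A)" and Vm: "V \<in> kmat K n (mrank A)"
    using compact_svdD(1,2)[OF svd] carrier_matD[OF kmatD[OF A]] by simp_all
  have "nrm EJ * nrm (pinv VJ) \<le> nrm E * nrm (pinv VJ)" "nrm EI * nrm (pinv WI) \<le> nrm E * nrm (pinv WI)"
    unfolding EI EJ VJ WI
    by (intro mult_right_mono nrm_submatrix_cols_le[OF E] nrm_submatrix_rows_le[OF E]
        nrm_nonneg[OF kmat_pinv[OF kmat_submatrix[OF Vm]]] nrm_nonneg[OF kmat_pinv[OF kmat_submatrix[OF Wm]]])+
  then show ?thesis using bound E0 by (simp add: algebra_simps)
qed

end
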